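(* Let $\mathcal K$ be a simplicial complex satisfying the standing assumptions. On the cochain space $C^q(\mathcal K,\mathbb C)$ the following formulas hold: $$D_q^{\mathrm{up}}=\frac1{q+1}\left(A_q^{\mathrm{up}}\mathcal L_q^{\mathrm{up}}A_q^{\mathrm{up}}-I\right)\quad(0\le q\le\dim\mathcal K-1),$$ $$D_q^{\mathrm{down}}=A_q^{\mathrm{down}}\left(\mathcal L_q^{\mathrm{down}}-(q+1)I\right)A_q^{\mathrm{down}}\quad(1\le q\le\dim\mathcal K),$$ where $(A_q^{\mathrm{up}}f)(\tau)=\frac{1}{\sqrt{\deg_X(\tau)}}f(\tau)$ and $(A_q^{\mathrm{down}}f)(\tau)=\frac{1}{\sqrt{\deg_Y(\tau)}}f(\tau)$.
   Context: Complexes. $\mathcal K=(V,\mathcal S)$ is an abstract simplicial complex: $V$ is a countable set, $\mathcal S$ is a family of finite subsets of $V$ closed under taking subsets, containing $\emptyset$ and all singletons. $\mathcal S_q$ is the set of simplices with $q+1$ elements (dimension $q$). Standing assumptions: (bounded degree) there is a constant $c$ such that every nonempty $F\in\mathcal S$ is contained in at most $c$ elements of $\mathcal S$; (finite dimension) $\dim\mathcal K:=\max\{\dim F: F\in\mathcal S\}<\infty$, and $\dim\mathcal K\ge 1$; (pure) every simplex is contained in a simplex of dimension $\dim\mathcal K$; (strongly connected) any two $\sigma_1,\sigma_2\in\mathcal S_{\dim\mathcal K}$ are joined by a sequence $\sigma_1=\tau_1,\dots,\tau_m=\sigma_2$ in $\mathcal S_{\dim\mathcal K}$ with $\tau_i\cap\tau_{i+1}\in\mathcal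 S_{\dim\mathcal K-1}$. Orientations. $\widehat K_q$ is the set of sequences $s=(a_0\cdots a_q)$ with $\{a_0,\dots,a_q\}\in\mathcal S_q$; $\mathfrak S_{q+1}$ acts by $s^\pi=(a_{\pi(0)}\cdots a_{\pi(q)})$. For $q\ge1$, $K_q=\widehat K_q/\mathfrak A_{q+1}$ (alternating group) is the set of oriented $q$-simplices; the class of $s$ is $\langle s\rangle$. Each $q$-simplex has two orientations, $\tau$ and its opposite $\overline\tau$. For $q=0$, $K_0=V\times\{\pm1\}$, $\langle (a)\rangle=(a,+1)$, $\overline{(a,\varepsilon)}=(a,-\varepsilon)$. $[\tau]\in\mathcal S_q$ denotes the underlying simplex of $\tau$. For $\sigma=\langle a_0\cdots a_q\rangle\in K_q$ and $\tau\in K_{q-1}$: $\mathrm{sgn}(\sigma,\tau)=(-1)^j$ if $\tau=\langle a_0\cdots\widehat{a_j}\cdots a_q\rangle$, $\mathrm{sgn}(\sigma,\tau)=-(-1)^j$ if $\overline\tau=\langle a_0\cdots\widehat{a_j}\cdots a_q\rangle$, and $\mathrm{sgn}(\sigma,\tau)=0$ if $[\tau]\not\subset[\sigma]$. Cochains and Laplacians. $\ell^2(K_q)$ has inner product $\langle f,g\rangle=\sum_{\tau\in K_q}f(\tau)\overline{g(\tau)}$, and $C^q(\mathcal K,\mathbb C)=\{f\in\ell^2(K_q): f(\overline\tau)=-f(\tau)\}$. The coboundary operator $\delta_q:C^q(\mathcal K,\mathbb C)\to C^{q+1}(\mathcal K,\mathbb C)$ is $(\delta_qf)(\sigma)=\frac12\sum_{\tau\in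 K_q}\mathrm{sgn}(\sigma,\tau)f(\tau)$. $\mathcal L_q^{\mathrm{up}}=\delta_q^*\delta_q$ and $\mathcal L_q^{\mathrm{down}}=\delta_{q-1}\delta_{q-1}^*$ on $C^q(\mathcal K,\mathbb C)$. Discriminants. Distinct $[\tau_1],[\tau_2]\in\mathcal S_q$ are up neighbors if both are contained in a common $(q+1)$-simplex, and (for $q\ge1$) down neighbors if $[\tau_1]\cap[\tau_2]\in\mathcal S_{q-1}$. For up neighbors, $\eta^{\mathrm{up}}(\tau_1,\tau_2)=\mathrm{sgn}(\sigma,\tau_1)\mathrm{sgn}(\sigma,\tau_2)$, where $\sigma\in K_{q+1}$ is either orientation of the unique common $(q+1)$-simplex; for down neighbors, $\eta^{\mathrm{down}}(\tau_1,\tau_2)=\mathrm{sgn}(\tau_1,\mu)\mathrm{sgn}(\tau_2,\mu)$, where $\mu\in K_{q-1}$ is either orientation of $[\tau_1]\cap[\tau_2]$. $\deg_X(\tau)$ is the number of $(q+1)$-simplices containing $[\tau]$; $\deg_Y(\tau)$ is the number of $[\tau']\in\mathcal S_q$ that are down neighbors of $[\tau]$. If $q=\dim\mathcal K$ it is assumed in the down case that $\mathcal S_q$ has at least two elements (so $\deg_Y\ge1$). On $\ell^2(K_q)$: $$(D_q^{\mathrm{up}}g)(\tau)=\sum_{\tau'\in K_q:\,[\tau'],[\tau]\text{ up neighbors}}\frac{\eta^{\mathrm{up}}(\tau,\tau')g(\tau')}{\sqrt{2(q+1)\deg_X(\tau)}\sqrt{2(q+1)\deg_X(\tau')}},$$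 $$(D_q^{\mathrm{down}}g)(\tau)=\sum_{\tau'\in K_q:\,[\tau'],[\tau]\text{ down neighbors}}\frac{\eta^{\mathrm{down}}(\tau,\tau')g(\tau')}{\sqrt{2\deg_Y(\tau)}\sqrt{2\deg_Y(\tau')}}.$$ *)

theory Defs
  imports "HOL-Analysis.Analysis" "HOL-Combinatorics.Permutations"
begin

section \<open>Simplicial complexes\<close>

definition q_simplices :: "'v set set \<Rightarrow> nat \<Rightarrow> 'v set set" where
  "q_simplices S q = {F \<in> S. card F = q + 1}"

text \<open>The truncated subtraction gives the empty simplex dimension 0 instead of \<open>-1\<close>. This does not
  change the maximum as soon as there is a vertex, which \<open>1 \<le> cdim S\<close> below guarantees.\<close>

definition cdim :: "'v set set \<Rightarrow> nat" where
  "cdim S = Max ((\<lambda>F. card F - 1) ` S)"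

definition simplicial_complex :: "'v set \<Rightarrow> 'v set set \<Rightarrow> bool" where
  "simplicial_complex V S \<longleftrightarrow>
     countable V \<and>
     (\<forall>F\<in>S. finite F \<and> F \<subseteq> V) \<and>
     (\<forall>F\<in>S. \<forall>G. G \<subseteq> F \<longrightarrow> G \<in> S) \<and>
     {} \<in> S \<and> (\<forall>a\<in>V. {a} \<in> S)"

definition bounded_degree :: "'v set set \<Rightarrow> bool" where
  "bounded_degree S \<longleftrightarrow>
     (\<exists>c::nat. \<forall>F\<in>S. F \<noteq> {} \<longrightarrow> finite {G \<in> S. F \<subseteq> G} \<and> card {G \<in> S. F \<subseteq> G} \<le> c)"

definition finite_dimensional :: "'v set set \<Rightarrow> bool" where
  "finite_dimensional S \<longleftrightarrow> finite ((\<lambda>F. card F - 1) ` S)"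

definition pure_complex :: "'v set set \<Rightarrow> bool" where
  "pure_complex S \<longleftrightarrow> (\<forall>F\<in>S. \<exists>G\<in>q_simplices S (cdim S). F \<subseteq> G)"

definition strongly_connected :: "'v set set \<Rightarrow> bool" where
  "strongly_connected S \<longleftrightarrow>
     (\<forall>F\<in>q_simplices S (cdim S). \<forall>G\<in>q_simplices S (cdim S).
        \<exists>ts. ts \<noteq> [] \<and> hd ts = F \<and> last ts = G \<and> set ts \<subseteq> q_simplices S (cdim S) \<and>
          (\<forall>i. Suc i < length ts \<longrightarrow> ts ! i \<inter> ts ! Suc i \<in> q_simplices S (cdim S - 1)))"

definition standing_assumptions :: "'v set \<Rightarrow> 'v set set \<Rightarrow> bool" where
  "standing_assumptions V S \<longleftrightarrow>
     simplicial_complex V S \<and> bounded_degree S \<and> finite_dimensional S \<and> 1 \<le> cdim S \<and>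
     pure_complex S \<and> strongly_connected S"


section \<open>Oriented simplices\<close>

text \<open>\<open>OVertex a e\<close> stands for the element \<open>(a, e)\<close> of \<open>K\<^sub>0\<close>, with \<open>e\<close> equal to \<open>1\<close> or \<open>-1\<close>;
  for \<open>q \<ge> 1\<close>, \<open>OClass C\<close> stands for an orbit \<open>C\<close> of the alternating group on sequences of
  \<open>q + 1\<close> vertices.\<close>

datatype 'v osimplex = OVertex 'v int | OClass "'v list set"

definition ordered_simplices :: "'v set set \<Rightarrow> nat \<Rightarrow> 'v list set" where
  "ordered_simplices S q = {s. length s = q + 1 \<and> set s \<in> q_simplices S q}"

text \<open>\<open>permute_list \<pi> s\<close> is the sequence with entries \<open>s ! \<pi> i\<close>.\<close>

definition alternating_orbit :: "'v list \<Rightarrow> 'v list set" where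
  "alternating_orbit s = {permute_list \<pi> s | \<pi>. \<pi> permutes {..<length s} \<and> evenperm \<pi>}"

definition orient :: "'v list \<Rightarrow> 'v osimplex" where
  "orient s = (if length s = 1 then OVertex (hd s) 1 else OClass (alternating_orbit s))"

text \<open>In a simplicial complex the vertex set is the union of all simplices.\<close>

definition osimplices :: "'v set set \<Rightarrow> nat \<Rightarrow> 'v osimplex set" where
  "osimplices S q =
     (if q = 0 then {OVertex a e | a e. a \<in> \<Union>S \<and> e \<in> {1, -1}}
      else orient ` ordered_simplices S q)"

fun opposite :: "'v osimplex \<Rightarrow> 'v osimplex" where
  "opposite (OVertex a e) = OVertex a (- e)"
| "opposite (OClass C) =
     OClass {permute_list \<pi> s | \<pi> s. s \<in> C \<and> \<pi> permutes {..<length s} \<and> \<not> evenperm \<pi>}"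

fun underlying :: "'v osimplex \<Rightarrow> 'v set" where
  "underlying (OVertex a e) = {a}"
| "underlying (OClass C) = (\<Union>s\<in>C. set s)"

definition delete_nth :: "nat \<Rightarrow> 'v list \<Rightarrow> 'v list" where
  "delete_nth j s = take j s @ drop (Suc j) s"

text \<open>The sign does not depend on the sequence \<open>s\<close> representing \<open>\<sigma>\<close>, so for a \<open>q\<close>-simplex \<open>\<sigma>\<close>
  and a \<open>(q - 1)\<close>-simplex \<open>\<tau>\<close> contained in it the description below is a proper one.\<close>

definition incidence_sgn :: "'v osimplex \<Rightarrow> 'v osimplex \<Rightarrow> int" where
  "incidence_sgn \<sigma> \<tau> =
     (if underlying \<tau> \<subseteq> underlying \<sigma>
      then (THE e. \<exists>s j. orient s = \<sigma> \<and> j < length s \<and>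
              (\<tau> = orient (delete_nth j s) \<and> e = (-1) ^ j \<or>
               opposite \<tau> = orient (delete_nth j s) \<and> e = - ((-1) ^ j)))
      else 0)"


section \<open>Cochains and Laplacians\<close>

text \<open>Functions on the oriented \<open>q\<close>-simplices are represented by functions on the whole type that
  vanish elsewhere.\<close>

definition ell2 :: "'v set set \<Rightarrow> nat \<Rightarrow> ('v osimplex \<Rightarrow> complex) set" where
  "ell2 S q = {f. (\<forall>\<tau>. \<tau> \<notin> osimplices S q \<longrightarrow> f \<tau> = 0) \<and>
                  (\<lambda>\<tau>. (cmod (f \<tau>))\<^sup>2) summable_on osimplices S q}"

definition ell2_inner ::
    "'v set set \<Rightarrow> nat \<Rightarrow> ('v osimplex \<Rightarrow> complex) \<Rightarrow> ('v osimplex \<Rightarrow> complex) \<Rightarrow> complex" where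
  "ell2_inner S q f g = (\<Sum>\<^sub>\<infinity>\<tau>\<in>osimplices S q. f \<tau> * cnj (g \<tau>))"

definition cochains :: "'v set set \<Rightarrow> nat \<Rightarrow> ('v osimplex \<Rightarrow> complex) set" where
  "cochains S q = {f \<in> ell2 S q. \<forall>\<tau>\<in>osimplices S q. f (opposite \<tau>) = - f \<tau>}"

definition coboundary ::
    "'v set set \<Rightarrow> nat \<Rightarrow> ('v osimplex \<Rightarrow> complex) \<Rightarrow> 'v osimplex \<Rightarrow> complex" where
  "coboundary S q f = (\<lambda>\<sigma>. if \<sigma> \<in> osimplices S (q + 1)
     then 1 / 2 * (\<Sum>\<^sub>\<infinity>\<tau>\<in>osimplices S q. of_int (incidence_sgn \<sigma> \<tau>) * f \<tau>)
     else 0)"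

text \<open>The Hilbert space adjoint of the coboundary operator, from \<open>cochains S (q + 1)\<close> to
  \<open>cochains S q\<close>.\<close>

definition coboundary_adj ::
    "'v set set \<Rightarrow> nat \<Rightarrow> ('v osimplex \<Rightarrow> complex) \<Rightarrow> 'v osimplex \<Rightarrow> complex" where
  "coboundary_adj S q g = (THE h. h \<in> cochains S q \<and>
     (\<forall>f\<in>cochains S q. ell2_inner S (q + 1) (coboundary S q f) g = ell2_inner S q f h))"

definition laplacian_up ::
    "'v set set \<Rightarrow> nat \<Rightarrow> ('v osimplex \<Rightarrow> complex) \<Rightarrow> 'v osimplex \<Rightarrow> complex" where
  "laplacian_up S q f = coboundary_adj S q (coboundary S q f)"

text \<open>Only meaningful for \<open>q \<ge> 1\<close>; the same holds for the other down notions below.\<close>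

definition laplacian_down ::
    "'v set set \<Rightarrow> nat \<Rightarrow> ('v osimplex \<Rightarrow> complex) \<Rightarrow> 'v osimplex \<Rightarrow> complex" where
  "laplacian_down S q f = coboundary S (q - 1) (coboundary_adj S (q - 1) f)"


section \<open>Discriminants\<close>

definition up_neighbors :: "'v set set \<Rightarrow> nat \<Rightarrow> 'v set \<Rightarrow> 'v set \<Rightarrow> bool" where
  "up_neighbors S q F G \<longleftrightarrow> F \<in> q_simplices S q \<and> G \<in> q_simplices S q \<and> F \<noteq> G \<and>
     (\<exists>H\<in>q_simplices S (q + 1). F \<subseteq> H \<and> G \<subseteq> H)"

definition down_neighbors :: "'v set set \<Rightarrow> nat \<Rightarrow> 'v set \<Rightarrow> 'v set \<Rightarrow> bool" where
  "down_neighbors S q F G \<longleftrightarrow> F \<in> q_simplices S q \<and> G \<in> q_simplices S q \<and> F \<noteq> G \<and>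
     F \<inter> G \<in> q_simplices S (q - 1)"

text \<open>For neighbors, the two orientations of the common coface (respectively of the intersection)
  give the same product of signs.\<close>

definition eta_up :: "'v set set \<Rightarrow> nat \<Rightarrow> 'v osimplex \<Rightarrow> 'v osimplex \<Rightarrow> int" where
  "eta_up S q \<tau>\<^sub>1 \<tau>\<^sub>2 = (THE e. \<exists>\<sigma>\<in>osimplices S (q + 1).
     underlying \<tau>\<^sub>1 \<subseteq> underlying \<sigma> \<and> underlying \<tau>\<^sub>2 \<subseteq> underlying \<sigma> \<and>
     e = incidence_sgn \<sigma> \<tau>\<^sub>1 * incidence_sgn \<sigma> \<tau>\<^sub>2)"

definition eta_down :: "'v set set \<Rightarrow> nat \<Rightarrow> 'v osimplex \<Rightarrow> 'v osimplex \<Rightarrow> int" where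
  "eta_down S q \<tau>\<^sub>1 \<tau>\<^sub>2 = (THE e. \<exists>\<mu>\<in>osimplices S (q - 1).
     underlying \<mu> = underlying \<tau>\<^sub>1 \<inter> underlying \<tau>\<^sub>2 \<and>
     e = incidence_sgn \<tau>\<^sub>1 \<mu> * incidence_sgn \<tau>\<^sub>2 \<mu>)"

definition deg_X :: "'v set set \<Rightarrow> nat \<Rightarrow> 'v osimplex \<Rightarrow> nat" where
  "deg_X S q \<tau> = card {F \<in> q_simplices S (q + 1). underlying \<tau> \<subseteq> F}"

definition deg_Y :: "'v set set \<Rightarrow> nat \<Rightarrow> 'v osimplex \<Rightarrow> nat" where
  "deg_Y S q \<tau> = card {F \<in> q_simplices S q. down_neighbors S q F (underlying \<tau>)}"

definition discriminant_up ::
    "'v set set \<Rightarrow> nat \<Rightarrow> ('v osimplex \<Rightarrow> complex) \<Rightarrow> 'v osimplex \<Rightarrow> complex" where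
  "discriminant_up S q g = (\<lambda>\<tau>. if \<tau> \<in> osimplices S q
     then \<Sum>\<^sub>\<infinity>\<tau>'\<in>{\<tau>' \<in> osimplices S q. up_neighbors S q (underlying \<tau>') (underlying \<tau>)}.
            of_int (eta_up S q \<tau> \<tau>') * g \<tau>' /
            of_real (sqrt (2 * (real q + 1) * real (deg_X S q \<tau>)) *
                     sqrt (2 * (real q + 1) * real (deg_X S q \<tau>')))
     else 0)"

definition discriminant_down ::
    "'v set set \<Rightarrow> nat \<Rightarrow> ('v osimplex \<Rightarrow> complex) \<Rightarrow> 'v osimplex \<Rightarrow> complex" where
  "discriminant_down S q g = (\<lambda>\<tau>. if \<tau> \<in> osimplices S q
     then \<Sum>\<^sub>\<infinity>\<tau>'\<in>{\<tau>' \<in> osimplices S q. down_neighbors S q (underlying \<tau>') (underlying \<tau>)}.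
            of_int (eta_down S q \<tau> \<tau>') * g \<tau>' /
            of_real (sqrt (2 * real (deg_Y S q \<tau>)) * sqrt (2 * real (deg_Y S q \<tau>')))
     else 0)"

definition A_up ::
    "'v set set \<Rightarrow> nat \<Rightarrow> ('v osimplex \<Rightarrow> complex) \<Rightarrow> 'v osimplex \<Rightarrow> complex" where
  "A_up S q f = (\<lambda>\<tau>. of_real (1 / sqrt (real (deg_X S q \<tau>))) * f \<tau>)"

definition A_down ::
    "'v set set \<Rightarrow> nat \<Rightarrow> ('v osimplex \<Rightarrow> complex) \<Rightarrow> 'v osimplex \<Rightarrow> complex" where
  "A_down S q f = (\<lambda>\<tau>. of_real (1 / sqrt (real (deg_Y S q \<tau>))) * f \<tau>)"

end

theory Submission
  imports Defs
begin

text \<open>Fixing a well-order of the vertices gives every simplex \<open>F\<close> a reference orientation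
  \<open>oriented F 1\<close>; an ordered simplex \<open>s\<close> then carries the sign \<open>list_sgn s\<close>, the parity of its
  inversions. In these terms the incidence number of \<open>oriented F e\<close> and \<open>oriented G d\<close> is
  \<open>e * d * face_sgn F G\<close>, and a cochain is determined by its values on the reference orientations, so
  that all operators become sums over unoriented simplices. Bounded degree makes the incidence matrix
  bounded on \<open>\<ell>\<^sup>2\<close>, so the adjoint of the coboundary is given by the transposed matrix. In
  \<open>\<delta>\<^sup>*\<delta>\<close> and \<open>\<delta>\<delta>\<^sup>*\<close> the diagonal terms contribute the degree, respectively
  \<open>q + 1\<close>, because \<open>(face_sgn F G)\<^sup>2 = 1\<close>; an off-diagonal pair of neighbors has a unique common coface
  \<open>G \<union> G'\<close>, respectively a unique common face \<open>F \<inter> F'\<close>, which gives the discriminant.\<close>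

section \<open>Signs of orderings\<close>

text \<open>Every type carries a well-order, so the choice exists; totality and antisymmetry make
  the sign flip when two distinct vertices are swapped.\<close>

definition vertex_sgn :: "'v \<Rightarrow> 'v \<Rightarrow> int" where
  "vertex_sgn a b =
     (if (a, b) \<in> (SOME r :: 'v rel. Well_order r \<and> Field r = UNIV) then 1 else -1)"

lemma vertex_sgn_cases: "vertex_sgn a b \<in> {1, -1}"
  by (simp add: vertex_sgn_def)

lemma vertex_sgn_swap:
  assumes "a \<noteq> b"
  shows "vertex_sgn a b = - vertex_sgn b a"
proof -
  define r :: "'a rel" where "r = (SOME r. Well_order r \<and> Field r = UNIV)"
  have "Well_order r \<and> Field r = UNIV"
    unfolding r_def by (rule someI_ex) (rule well_ordering)
  then have "antisym r" "total_on UNIV r"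
    by (auto simp: order_on_defs)
  then have "(a, b) \<in> r \<longleftrightarrow> (b, a) \<notin> r"
    using assms by (auto simp: total_on_def antisym_def)
  then show ?thesis
    by (simp add: vertex_sgn_def r_def)
qed

fun list_sgn :: "'v list \<Rightarrow> int" where
  "list_sgn [] = 1"
| "list_sgn (x # xs) = (\<Prod>y\<leftarrow>xs. vertex_sgn x y) * list_sgn xs"

lemma prod_list_vertex_sgn_cases: "(\<Prod>y\<leftarrow>ys. vertex_sgn x y) \<in> {1, -1}"
  by (induction ys) (use vertex_sgn_cases in fastforce)+

lemma list_sgn_cases: "list_sgn xs \<in> {1, -1}"
  by (induction xs) (use prod_list_vertex_sgn_cases in fastforce)+

text \<open>Each entry of \<open>xs\<close> stands before \<open>b\<close> and so enters as
  \<open>vertex_sgn x b\<close>; rewriting it as \<open>- vertex_sgn b x\<close> costs one factor -1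
  per entry. The formula serves both exchanging and deleting entries.\<close>

lemma list_sgn_insert:
  assumes "b \<notin> set (xs @ ys)"
  shows "list_sgn (xs @ b # ys) =
           (-1) ^ length xs * (\<Prod>y\<leftarrow>xs @ ys. vertex_sgn b y) * list_sgn (xs @ ys)"
  using assms
proof (induction xs)
  case (Cons x xs)
  then have "vertex_sgn x b = - vertex_sgn b x"
    by (intro vertex_sgn_swap) auto
  with Cons show ?case by simp
qed simp

text \<open>After \<open>a\<close> and \<open>b\<close> are pulled out of both lists, the powers of
  -1 and the products over the remaining entries agree; only the factor for the pair itself,
  \<open>vertex_sgn a b\<close> against \<open>vertex_sgn b a\<close>, differs.\<close>

lemma list_sgn_exchange:
  assumes "distinct (xs @ a # ys @ b # zs)"
  shows "list_sgn (xs @ b # ys @ a # zs) = - list_sgn (xs @ a # ys @ b # zs)"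
proof -
  have ab: "vertex_sgn a b = - vertex_sgn b a"
    using assms by (intro vertex_sgn_swap) auto
  have "list_sgn (xs @ a # ys @ b # zs) = (-1) ^ length xs *
          (\<Prod>y\<leftarrow>xs @ ys @ b # zs. vertex_sgn a y) * list_sgn ((xs @ ys) @ b # zs)"
    using assms by (subst list_sgn_insert) auto
  also have "\<dots> = - ((-1) ^ length xs *
          (\<Prod>y\<leftarrow>xs @ ys @ a # zs. vertex_sgn b y) * list_sgn ((xs @ ys) @ a # zs))"
    using assms ab by (subst (1 2) list_sgn_insert) auto
  also have "\<dots> = - list_sgn (xs @ b # ys @ a # zs)"
    using assms by (subst (2) list_sgn_insert) auto
  finally show ?thesis by simp
qed

section \<open>Permutations and the sign of an ordering\<close>

lemma permute_list_transpose:
  assumes "i < length xs" "j < length xs"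
  shows "permute_list (Transposition.transpose i j) xs = xs[i := xs ! j, j := xs ! i]"
  using assms
  by (auto simp: permute_list_def transpose_def nth_list_update intro!: nth_equalityI)

lemma list_sgn_transpose:
  assumes "distinct xs" "i < length xs" "j < length xs" "i \<noteq> j"
  shows "list_sgn (permute_list (Transposition.transpose i j) xs) = - list_sgn xs"
proof -
  have *: "list_sgn (permute_list (Transposition.transpose i j) xs) = - list_sgn xs"
    if "i < j" "j < length xs" for i j
  proof -
    define as bs where "as = take i xs" "bs = drop (Suc i) (take j xs)"
    have "xs = take j xs @ xs ! j # drop (Suc j) xs"
      using that by (simp add: id_take_nth_drop)
    moreover have "take j xs = as @ xs ! i # bs"
      using that id_take_nth_drop[of i "take j xs"] by (simp add: as_bs_def min_def)
    ultimately have xs: "xs = as @ xs ! i # bs @ xs ! j # drop (Suc j) xs"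
      by simp
    have l: "length as = i" "j = i + Suc (length bs)"
      using that by (auto simp: as_bs_def)
    obtain a b cs where xs': "xs = as @ a # bs @ b # cs" using xs by blast
    have "permute_list (Transposition.transpose i j) xs = as @ b # bs @ a # cs"
      using that l by (simp add: permute_list_transpose xs' nth_append list_update_append)
    then show ?thesis
      using assms(1) list_sgn_exchange[of as a bs b cs] by (simp add: xs')
  qed
  show ?thesis
    using *[of i j] *[of j i] assms by (cases "i < j") (auto simp: transpose_commute)
qed

lemma list_sgn_permute_list:
  assumes "p permutes {..<length xs}" "distinct xs"
  shows "list_sgn (permute_list p xs) = sign p * list_sgn xs"
proof -
  define n where "n = length xs"
  \<comment> \<open>The list is generalised because a composition acts in two stages:
    \<open>p\<close> is applied to the transposed list, and the induction hypothesis is needed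
    there.\<close>
  have "\<forall>xs :: 'a list. distinct xs \<and> length xs = n \<longrightarrow> list_sgn (permute_list p xs) = sign p * list_sgn xs"
    using assms(1)[folded n_def] finite_lessThan
  proof (induction rule: permutes_induct)
    case (swap a b p)
    have "permutation p" "permutation (Transposition.transpose a b)"
      using swap.hyps by (auto simp: permutation_swap_id intro: permutation_permutes[THEN iffD2])
    then have s: "sign (Transposition.transpose a b \<circ> p) = - sign p"
      using swap.hyps by (simp add: sign_compose sign_swap_id)
    show ?case
    proof (intro allI impI)
      fix xs :: "'a list" assume xs: "distinct xs \<and> length xs = n"
      have t: "Transposition.transpose a b permutes {..<length xs}"
        using swap.hyps xs by (intro permutes_swap_id) auto
      show "list_sgn (permute_list (Transposition.transpose a b \<circ> p) xs) =
              sign (Transposition.transpose a b \<circ> p) * list_sgn xs"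
        using swap.IH[rule_format, of "permute_list (Transposition.transpose a b) xs"]
          swap.hyps xs t by (simp add: permute_list_compose s list_sgn_transpose)
    qed
  qed simp_all
  then show ?thesis using assms by (simp add: n_def)
qed

lemma distinct_set_eq_permute_list:
  assumes "distinct xs" "distinct ys" "set xs = set ys"
  obtains p where "p permutes {..<length ys}" "permute_list p ys = xs"
  using assms by (metis mset_eq_permutation set_eq_iff_mset_eq_distinct)

text \<open>Any reordering of \<open>s\<close> comes from some permutation, and comparing list signs
  forces the sign of that permutation. For \<open>e = 1\<close> this is the orbit of the alternating
  group, for \<open>e = -1\<close> the other coset.\<close>

lemma permute_list_orbit:
  assumes "distinct s"
  shows "{permute_list p s | p. p permutes {..<length s} \<and> sign p = e} =
           {t. distinct t \<and> set t = set s \<and> list_sgn t = e * list_sgn s}"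
proof (intro equalityI subsetI)
  fix t assume t: "t \<in> {t. distinct t \<and> set t = set s \<and> list_sgn t = e * list_sgn s}"
  then obtain p where p: "p permutes {..<length s}" "permute_list p s = t"
    using distinct_set_eq_permute_list[of t s] assms by auto
  moreover have "sign p = e"
    using list_sgn_permute_list[OF p(1) assms] p t list_sgn_cases[of s] by auto
  ultimately show "t \<in> {permute_list p s | p. p permutes {..<length s} \<and> sign p = e}"
    by blast
qed (use assms in \<open>auto simp: list_sgn_permute_list\<close>)

text \<open>An arbitrary ordering, or the one with its first two entries exchanged, has the wanted
  sign. A singleton admits only the sign 1, which is why vertices are oriented by explicit signed
  pairs.\<close>

lemma ex_list_sgn:
  assumes "finite F" "2 \<le> card F" "e \<in> {1, -1}"
  obtains s where "distinct s" "set s = F" "list_sgn s = e"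
proof -
  obtain s where s: "distinct s" "set s = F"
    using finite_distinct_list[OF assms(1)] by auto
  then have len: "2 \<le> length s" using assms by (simp add: distinct_card[symmetric])
  define t where "t = permute_list (Transposition.transpose 0 1) s"
  have "Transposition.transpose 0 1 permutes {..<length s}"
    using len by (intro permutes_swap_id) auto
  then have "distinct t" "set t = F" "list_sgn t = - list_sgn s"
    using s len list_sgn_transpose[of s 0 1] by (auto simp: t_def simp flip: length_greater_0_conv)
  with s that list_sgn_cases[of s] assms(3) show ?thesis by auto
qed

section \<open>Signed simplices\<close>

text \<open>The orientation of the simplex \<open>F\<close> of sign \<open>e\<close> relative to the chosen well-order of the vertices.\<close>

definition oriented :: "'v set \<Rightarrow> int \<Rightarrow> 'v osimplex" where
  "oriented F e = (if card F = 1 then OVertex (the_elem F) e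
                   else OClass {s. distinct s \<and> set s = F \<and> list_sgn s = e})"

lemma orient_eq_oriented:
  assumes "distinct s"
  shows "orient s = oriented (set s) (list_sgn s)"
proof (cases "length s = 1")
  case True
  then obtain a where "s = [a]" by (auto simp: length_Suc_conv)
  then show ?thesis by (simp add: orient_def oriented_def)
next
  case False
  have "alternating_orbit s =
          {permute_list p s | p. p permutes {..<length s} \<and> sign p = 1}"
    by (auto simp: alternating_orbit_def sign_def)
  then show ?thesis
    using False assms by (simp add: orient_def oriented_def permute_list_orbit distinct_card)
qed

lemma card_ge_2:
  assumes "finite F" "F \<noteq> {}" "card F \<noteq> 1"
  shows "2 \<le> card F"
  using assms by (metis One_nat_def Suc_leI card_gt_0_iff le_neq_implies_less numeral_2_eq_2)

lemma opposite_oriented: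
  assumes "finite F" "F \<noteq> {}" "e \<in> {1, -1}"
  shows "opposite (oriented F e) = oriented F (- e)"
proof (cases "card F = 1")
  case False
  define C where "C = {s. distinct s \<and> set s = F \<and> list_sgn s = e}"
  obtain s where s: "s \<in> C"
    using ex_list_sgn[of F e] card_ge_2[OF assms(1,2) False] assms by (auto simp: C_def)
  \<comment> \<open>Each representative yields the same set of odd rearrangements, so the union over
    the class collapses to one set; the witness \<open>s\<close> keeps that union from being
    empty.\<close>
  have sub: "{permute_list p s | p. p permutes {..<length s} \<and> \<not> evenperm p} =
          {s. distinct s \<and> set s = F \<and> list_sgn s = - e}" if "s \<in> C" for s
  proof -
    have "{permute_list p s | p. p permutes {..<length s} \<and> \<not> evenperm p} =
          {permute_list p s | p. p permutes {..<length s} \<and> sign p = -1}"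
      by (auto simp: sign_def)
    with that show ?thesis by (simp add: C_def permute_list_orbit)
  qed
  have "{permute_list p s | p s. s \<in> C \<and> p permutes {..<length s} \<and> \<not> evenperm p} =
          (\<Union>s\<in>C. {permute_list p s | p. p permutes {..<length s} \<and> \<not> evenperm p})"
    by blast
  also have "\<dots> = {s. distinct s \<and> set s = F \<and> list_sgn s = - e}"
    using sub s by auto
  finally show ?thesis
    using False by (simp add: oriented_def C_def)
qed (simp add: oriented_def)

lemma underlying_oriented:
  assumes "finite F" "F \<noteq> {}" "e \<in> {1, -1}"
  shows "underlying (oriented F e) = F"
proof (cases "card F = 1")
  case True
  then show ?thesis by (auto simp: oriented_def card_1_singleton_iff)
next
  case False
  obtain s where "distinct s" "set s = F" "list_sgn s = e"
    using ex_list_sgn[of F e] card_ge_2[OF assms(1,2) False] assms by auto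
  then show ?thesis using False by (auto simp: oriented_def)
qed

text \<open>The underlying set recovers the simplex. With at least two vertices, an ordering of sign
  \<open>e\<close> lies in the first class, and its membership in the second forces
  \<open>d = e\<close>.\<close>

lemma oriented_inject:
  assumes "finite F" "F \<noteq> {}" "e \<in> {1, -1}" "finite G" "G \<noteq> {}" "d \<in> {1, -1}"
  shows "oriented F e = oriented G d \<longleftrightarrow> F = G \<and> e = d"
proof
  assume eq: "oriented F e = oriented G d"
  then have FG: "F = G"
    using assms underlying_oriented by metis
  show "F = G \<and> e = d"
  proof (cases "card F = 1")
    case False
    obtain s where "distinct s" "set s = F" "list_sgn s = e"
      using ex_list_sgn[of F e] card_ge_2[OF assms(1,2) False] assms by auto
    then show ?thesis using eq FG False by (auto simp: oriented_def)
  qed (use eq FG in \<open>auto simp: oriented_def\<close>)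
qed simp

text \<open>The sign of the \<open>j\<close>-th face contributes \<open>(-1) ^ j\<close> relative to \<open>list_sgn\<close>; the remaining factor
  depends only on the two underlying sets.\<close>

definition face_sgn :: "'v set \<Rightarrow> 'v set \<Rightarrow> int" where
  "face_sgn F G = (\<Prod>b\<in>G. vertex_sgn (the_elem (F - G)) b)"

lemma face_sgn_cases: "face_sgn F G \<in> {1, -1}"
proof -
  have "(\<Prod>b\<in>G. vertex_sgn a b) \<in> {1, -1}" for a :: 'a
    by (induction G rule: infinite_finite_induct) (use vertex_sgn_cases in fastforce)+
  then show ?thesis by (simp add: face_sgn_def)
qed

lemma face_sgn_square [simp]: "face_sgn F G * face_sgn F G = 1"
  using face_sgn_cases[of F G] by auto

text \<open>Removing the vertex at position \<open>j\<close> removes exactly the factor described by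
  \<open>list_sgn_insert\<close>: the sign \<open>(-1) ^ j\<close> and the comparisons with the
  remaining vertices, which form the face sign.\<close>

lemma orient_delete_nth:
  assumes "distinct s" "j < length s"
  shows "orient (delete_nth j s) =
           oriented (set s - {s ! j}) ((-1) ^ j * list_sgn s * face_sgn (set s) (set s - {s ! j}))"
proof -
  obtain xs b ys where s: "s = xs @ b # ys" and j: "j = length xs"
    using assms(2) id_take_nth_drop[of j s] by (metis length_take min.absorb4)
  have d: "delete_nth j s = xs @ ys" "s ! j = b" "set s - {b} = set (xs @ ys)"
    and dist: "distinct (xs @ ys)" "b \<notin> set (xs @ ys)"
    using assms(1) by (auto simp: s j delete_nth_def)
  have "set s - set (xs @ ys) = {b}"
    using dist by (auto simp: s)
  then have "face_sgn (set s) (set (xs @ ys)) = (\<Prod>y\<leftarrow>xs @ ys. vertex_sgn b y)"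
    using dist by (simp only: face_sgn_def prod.distinct_set_conv_list) simp
  then have "list_sgn s = (-1) ^ j * face_sgn (set s) (set (xs @ ys)) * list_sgn (xs @ ys)"
    using list_sgn_insert[OF dist(2)] by (simp only: s j)
  \<comment> \<open>Signs are their own inverses, so the relation can be solved for the shorter
    list.\<close>
  then have "list_sgn (xs @ ys) = (-1) ^ j * list_sgn s * face_sgn (set s) (set (xs @ ys))"
    using face_sgn_cases[of "set s" "set (xs @ ys)"] by (cases "even j") auto
  then show ?thesis
    using dist by (simp only: d orient_eq_oriented)
qed

text \<open>\<open>incidence_sgn\<close> quantifies over all lists representing a simplex, so its
  evaluation needs this converse of \<open>orient_eq_oriented\<close>. The identity permutation puts
  \<open>s\<close> into its own orbit, and at least two vertices exclude the \<open>OVertex\<close>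
  encoding.\<close>

lemma orient_eq_orientedD:
  assumes "orient s = oriented F e" "finite F" "2 \<le> card F" "e \<in> {1, -1}"
  shows "distinct s \<and> set s = F \<and> list_sgn s = e"
proof -
  have "length s \<noteq> 1"
    using assms by (auto simp: orient_def oriented_def)
  then have "alternating_orbit s = {s. distinct s \<and> set s = F \<and> list_sgn s = e}"
    using assms by (simp add: orient_def oriented_def)
  moreover have "s \<in> alternating_orbit s"
    unfolding alternating_orbit_def
    by (intro CollectI exI[of _ id]) (simp add: permutes_id evenperm_id)
  ultimately show ?thesis by blast
qed

section \<open>Evaluation of incidence numbers\<close>

lemma neg_one_power_cases: "(-1) ^ j \<in> {1, -1 :: int}"
  by (cases "even j") auto

text \<open>Here \<open>m\<close> is the sign \<open>(-1) ^ j\<close> of the deleted position and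
  \<open>c\<close> the face sign. The two alternatives in the definition of
  \<open>incidence_sgn\<close> merge into one value that no longer mentions
  \<open>m\<close>.\<close>

lemma sign_solve:
  fixes c d e m x :: int
  assumes "m \<in> {1, -1}" "e \<in> {1, -1}" "d \<in> {1, -1}" "c \<in> {1, -1}"
  shows "d = m * e * c \<and> x = m \<or> - d = m * e * c \<and> x = - m \<longleftrightarrow> x = e * d * c"
  using assms by (elim insertE emptyE) auto

lemma incidence_sgn_oriented:
  assumes "finite F" "finite G" "G \<noteq> {}" "card F = Suc (card G)"
    and e: "e \<in> {1, -1}" and d: "d \<in> {1, -1}"
  shows "incidence_sgn (oriented F e) (oriented G d) =
           (if G \<subseteq> F then e * d * face_sgn F G else 0)"
proof (cases "G \<subseteq> F")
  case True
  with assms have finG: "finite G" "G \<subseteq> F" by auto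
  have card2: "2 \<le> card F" and F: "F \<noteq> {}"
    using assms finG by (auto simp: Suc_le_eq card_gt_0_iff)
  have "card (F - G) = 1"
    using assms finG by (simp add: card_Diff_subset)
  then obtain a where a: "F - G = {a}" by (auto simp: card_1_singleton_iff)
  define P where "P = (\<lambda>x. \<exists>s j. orient s = oriented F e \<and> j < length s \<and>
              (oriented G d = orient (delete_nth j s) \<and> x = (-1) ^ j \<or>
               opposite (oriented G d) = orient (delete_nth j s) \<and> x = - ((-1) ^ j :: int)))"
  \<comment> \<open>For every representing list, the deleted face is \<open>G\<close> up to
    orientation exactly at the position of the missing vertex \<open>a\<close>, and the value
    depends neither on the list nor on the position. This is the well-definedness of the
    sign.\<close>
  have step: "(oriented G d = orient (delete_nth j s) \<and> x = (-1) ^ j \<or>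
               opposite (oriented G d) = orient (delete_nth j s) \<and> x = - ((-1) ^ j)) \<longleftrightarrow>
              s ! j = a \<and> x = e * d * face_sgn F G"
    if s: "distinct s" "set s = F" "list_sgn s = e" and j: "j < length s" for s j x
  proof -
    have mem: "s ! j \<in> F" using s j by auto
    then have ne: "F - {s ! j} \<noteq> {}"
      using card2 by (metis Diff_eq_empty_iff card.empty card_1_singleton_iff subset_singletonD
          Suc_1 not_less_eq_eq le0 One_nat_def F)
    have sg: "(-1) ^ j * e * face_sgn F (F - {s ! j}) \<in> {1, -1 :: int}"
      using e face_sgn_cases[of F "F - {s ! j}"] by (cases "even j") auto
    have iff: "G = F - {s ! j} \<longleftrightarrow> s ! j = a"
      using a finG mem by auto
    have 1: "oriented G d = orient (delete_nth j s) \<longleftrightarrow>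
            s ! j = a \<and> d = (-1) ^ j * e * face_sgn F G"
      using s j orient_delete_nth[OF s(1) j] sg ne assms finG iff
      by (auto simp: oriented_inject)
    have "- d \<in> {1, -1}" using assms by auto
    then have 2: "opposite (oriented G d) = orient (delete_nth j s) \<longleftrightarrow>
            s ! j = a \<and> - d = (-1) ^ j * e * face_sgn F G"
      using s j orient_delete_nth[OF s(1) j] sg ne assms finG iff
      by (auto simp: oriented_inject opposite_oriented)
    show ?thesis
      unfolding 1 2 using sign_solve[OF neg_one_power_cases[of j] e d face_sgn_cases[of F G]]
      by blast
  qed
  obtain s where s: "distinct s" "set s = F" "list_sgn s = e"
    using ex_list_sgn[of F e] assms card2 by auto
  obtain j where j: "j < length s" "s ! j = a"
    using a s(2) by (metis DiffE in_set_conv_nth insertI1)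
  \<comment> \<open>An equivalence gives existence and uniqueness at once, so the definite
    description evaluates.\<close>
  have "P x \<longleftrightarrow> x = e * d * face_sgn F G" for x
  proof
    assume "P x"
    then obtain s j where s: "orient s = oriented F e" and j: "j < length s" and
      x: "oriented G d = orient (delete_nth j s) \<and> x = (-1) ^ j \<or>
          opposite (oriented G d) = orient (delete_nth j s) \<and> x = - ((-1) ^ j)"
      unfolding P_def by blast
    from orient_eq_orientedD[OF s assms(1) card2 e] x step[OF _ _ _ j]
    show "x = e * d * face_sgn F G" by blast
  next
    assume x: "x = e * d * face_sgn F G"
    have "orient s = oriented F e" using s by (simp add: orient_eq_oriented)
    then show "P x"
      unfolding P_def using step[OF s j(1), of x] j x by blast
  qed
  then have "(THE x. P x) = e * d * face_sgn F G" by simp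
  then show ?thesis
    using finG assms F by (simp add: incidence_sgn_def underlying_oriented P_def)
next
  case False
  moreover have "F \<noteq> {}" using assms by auto
  ultimately show ?thesis
    using assms by (simp add: incidence_sgn_def underlying_oriented)
qed

text \<open>This puts vertices, encoded by signed pairs, and higher simplices, encoded by orbits, on
  one footing. For \<open>q \<ge> 1\<close> at least two vertices are present, so both signs come
  from actual orderings.\<close>

lemma osimplices_eq:
  assumes "simplicial_complex V S"
  shows "osimplices S q = (\<lambda>(F, e). oriented F e) ` (q_simplices S q \<times> {1, -1})"
proof (cases "q = 0")
  case True
  have "a \<in> \<Union>S \<longleftrightarrow> {a} \<in> S" for a
    using assms by (auto simp: simplicial_complex_def)
  then have "osimplices S q = {OVertex a e | a e. {a} \<in> S \<and> e \<in> {1, -1}}"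
    using True by (simp add: osimplices_def)
  also have "\<dots> = (\<lambda>(a, e). oriented {a} e) ` ({a. {a} \<in> S} \<times> {1, -1})"
    by (auto simp: oriented_def)
  also have "\<dots> = (\<lambda>(F, e). oriented F e) ` (((\<lambda>a. {a}) ` {a. {a} \<in> S}) \<times> {1, -1})"
    by (force simp: image_iff)
  also have "(\<lambda>a. {a}) ` {a. {a} \<in> S} = q_simplices S q"
    using True by (auto simp: q_simplices_def card_1_singleton_iff)
  finally show ?thesis .
next
  case False
  have dist: "distinct s" if "s \<in> ordered_simplices S q" for s
    using that by (intro card_distinct) (auto simp: ordered_simplices_def q_simplices_def)
  have "orient ` ordered_simplices S q = (\<lambda>(F, e). oriented F e) ` (q_simplices S q \<times> {1, -1})"
  proof (intro equalityI subsetI)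
    fix x assume "x \<in> orient ` ordered_simplices S q"
    then obtain s where s: "s \<in> ordered_simplices S q" "x = orient s" by blast
    then have "x = oriented (set s) (list_sgn s)" "set s \<in> q_simplices S q"
      using dist by (auto simp: orient_eq_oriented ordered_simplices_def)
    then show "x \<in> (\<lambda>(F, e). oriented F e) ` (q_simplices S q \<times> {1, -1})"
      using list_sgn_cases[of s] by fastforce
  next
    fix x assume "x \<in> (\<lambda>(F, e). oriented F e) ` (q_simplices S q \<times> {1, -1})"
    then obtain F e where x: "x = oriented F e" "F \<in> q_simplices S q" "e \<in> {1, -1}"
      by (elim imageE SigmaE) auto
    moreover have "finite F" "2 \<le> card F"
      using x False assms by (auto simp: q_simplices_def simplicial_complex_def)
    ultimately obtain s where s: "distinct s" "set s = F" "list_sgn s = e"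
      using ex_list_sgn by blast
    then have "s \<in> ordered_simplices S q"
      using x by (auto simp: ordered_simplices_def q_simplices_def distinct_card[symmetric])
    moreover have "orient s = x" using s x by (simp add: orient_eq_oriented)
    ultimately show "x \<in> orient ` ordered_simplices S q" by blast
  qed
  then show ?thesis using False by (simp add: osimplices_def)
qed

section \<open>Incidence matrices with bounded rows and columns\<close>

text \<open>Each \<open>h x\<close> is repeated for at most \<open>c\<close> partners, so the
  iterated sum is dominated by \<open>c\<close> times the sum of \<open>h\<close>.\<close>

lemma incident_summable:
  fixes h :: "'a \<Rightarrow> real"
  assumes h: "h summable_on X" and nonneg: "\<And>x. x \<in> X \<Longrightarrow> 0 \<le> h x"
    and bounded: "\<And>x. x \<in> X \<Longrightarrow> finite {y \<in> Y. P x y} \<and> card {y \<in> Y. P x y} \<le> c"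
  shows "(\<lambda>(x, y). if P x y then h x else 0) summable_on X \<times> Y"
proof (rule summable_on_SigmaI)
  fix x assume x: "x \<in> X"
  have "((\<lambda>y. h x) has_sum (\<Sum>y\<in>{y \<in> Y. P x y}. h x)) {y \<in> Y. P x y}"
    using bounded[OF x] by (intro has_sum_finite) auto
  also have "?this \<longleftrightarrow> ((\<lambda>y. case (x, y) of (x, y) \<Rightarrow> if P x y then h x else 0) has_sum
                        (\<Sum>y\<in>{y \<in> Y. P x y}. h x)) Y"
    by (intro has_sum_cong_neutral) auto
  finally show "((\<lambda>y. case (x, y) of (x, y) \<Rightarrow> if P x y then h x else 0) has_sum
                  real (card {y \<in> Y. P x y}) * h x) Y"
    by simp
next
  show "(\<lambda>x. real (card {y \<in> Y. P x y}) * h x) summable_on X"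
  proof (rule summable_on_comparison_test)
    show "(\<lambda>x. real c * h x) summable_on X"
      using h by (rule summable_on_cmult_right)
  qed (use bounded nonneg in \<open>auto intro: mult_right_mono\<close>)
qed (use nonneg in auto)

text \<open>An elementary case of the Schur test: under these bounds the matrix maps square-summable
  families over \<open>Y\<close> to such families over \<open>X\<close>, and its transpose goes the
  other way.\<close>

locale bounded_incidence =
  fixes X :: "'a set" and Y :: "'b set" and M :: "'a \<Rightarrow> 'b \<Rightarrow> complex" and r c :: nat
  assumes norm_le_1: "\<And>x y. cmod (M x y) \<le> 1"
    and row: "\<And>x. x \<in> X \<Longrightarrow> finite {y \<in> Y. M x y \<noteq> 0} \<and> card {y \<in> Y. M x y \<noteq> 0} \<le> r"
    and col: "\<And>y. y \<in> Y \<Longrightarrow> finite {x \<in> X. M x y \<noteq> 0} \<and> card {x \<in> X. M x y \<noteq> 0} \<le> c"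
begin

lemma transposed: "bounded_incidence Y X (\<lambda>y x. M x y) c r"
  using norm_le_1 row col by unfold_locales auto

lemma summable_pairs:
  assumes f: "(\<lambda>y. (cmod (f y))\<^sup>2) summable_on Y"
  shows "(\<lambda>(x, y). if M x y \<noteq> 0 then (cmod (f y))\<^sup>2 else 0) summable_on X \<times> Y"
proof -
  have "(\<lambda>(y, x). if M x y \<noteq> 0 then (cmod (f y))\<^sup>2 else 0) summable_on Y \<times> X"
    using f col by (intro incident_summable) auto
  also have "?this \<longleftrightarrow> ?thesis"
    by (intro summable_on_reindex_bij_witness[of _ prod.swap prod.swap]) auto
  finally show ?thesis .
qed

text \<open>Cauchy-Schwarz over the at most \<open>r\<close> nonzero entries of a row bounds each
  squared value by \<open>r\<close> times the squares met by that row; \<open>summable_pairs\<close>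
  makes these bounds summable over all rows.\<close>

lemma summable_square:
  assumes f: "(\<lambda>y. (cmod (f y))\<^sup>2) summable_on Y"
  shows "(\<lambda>x. (cmod (\<Sum>\<^sub>\<infinity>y\<in>Y. M x y * f y))\<^sup>2) summable_on X"
proof (rule summable_on_comparison_test)
  let ?R = "\<lambda>x. {y \<in> Y. M x y \<noteq> 0}"
  have "(\<lambda>(x, y). if M x y \<noteq> 0 then (cmod (f y))\<^sup>2 else 0) summable_on X \<times> Y"
    using f by (rule summable_pairs)
  then have "(\<lambda>x. \<Sum>\<^sub>\<infinity>y\<in>Y. if M x y \<noteq> 0 then (cmod (f y))\<^sup>2 else 0) summable_on X"
    using summable_on_Sigma_banach by fastforce
  then show "(\<lambda>x. real r * (\<Sum>\<^sub>\<infinity>y\<in>Y. if M x y \<noteq> 0 then (cmod (f y))\<^sup>2 else 0)) summable_on X"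
    by (rule summable_on_cmult_right)
  fix x assume x: "x \<in> X"
  have fin: "finite (?R x)" "card (?R x) \<le> r" using row[OF x] by auto
  have "(\<Sum>\<^sub>\<infinity>y\<in>Y. M x y * f y) = (\<Sum>\<^sub>\<infinity>y\<in>?R x. M x y * f y)"
    by (intro infsum_cong_neutral) auto
  also have "\<dots> = (\<Sum>y\<in>?R x. M x y * f y)"
    using fin by simp
  also have "cmod \<dots> \<le> (\<Sum>y\<in>?R x. cmod (f y))"
    using norm_le_1 by (intro sum_norm_le) (simp add: norm_mult mult_left_le_one_le)
  finally have "(cmod (\<Sum>\<^sub>\<infinity>y\<in>Y. M x y * f y))\<^sup>2 \<le> (\<Sum>y\<in>?R x. cmod (f y))\<^sup>2"
    by (intro power_mono) auto
  also have "\<dots> \<le> real (card (?R x)) * (\<Sum>y\<in>?R x. (cmod (f y))\<^sup>2)"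
    using sum_squared_le_sum_of_squares[of "\<lambda>y. cmod (f y)" "?R x"] by (simp add: mult.commute)
  also have "\<dots> \<le> real r * (\<Sum>y\<in>?R x. (cmod (f y))\<^sup>2)"
    using fin by (intro mult_right_mono sum_nonneg) auto
  also have "(\<Sum>y\<in>?R x. (cmod (f y))\<^sup>2) = (\<Sum>\<^sub>\<infinity>y\<in>?R x. (cmod (f y))\<^sup>2)"
    using fin by simp
  also have "\<dots> = (\<Sum>\<^sub>\<infinity>y\<in>Y. if M x y \<noteq> 0 then (cmod (f y))\<^sup>2 else 0)"
    by (intro infsum_cong_neutral) auto
  finally show "(cmod (\<Sum>\<^sub>\<infinity>y\<in>Y. M x y * f y))\<^sup>2 \<le>
                  real r * (\<Sum>\<^sub>\<infinity>y\<in>Y. if M x y \<noteq> 0 then (cmod (f y))\<^sup>2 else 0)" .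
qed auto

text \<open>This is Fubini's theorem. On the support of \<open>M\<close> the summand is dominated by
  the sum of the squares of \<open>f\<close> and \<open>g\<close>, which are summable over pairs by
  the column and the row bound respectively.\<close>

lemma infsum_adjoint:
  assumes f: "(\<lambda>y. (cmod (f y))\<^sup>2) summable_on Y" and g: "(\<lambda>x. (cmod (g x))\<^sup>2) summable_on X"
  shows "(\<Sum>\<^sub>\<infinity>x\<in>X. (\<Sum>\<^sub>\<infinity>y\<in>Y. M x y * f y) * cnj (g x)) =
         (\<Sum>\<^sub>\<infinity>y\<in>Y. f y * (\<Sum>\<^sub>\<infinity>x\<in>X. M x y * cnj (g x)))"
proof -
  have 1: "(\<lambda>(x, y). if M x y \<noteq> 0 then (cmod (f y))\<^sup>2 else 0) summable_on X \<times> Y"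
    using f by (rule summable_pairs)
  have 2: "(\<lambda>(x, y). if M x y \<noteq> 0 then (cmod (g x))\<^sup>2 else 0) summable_on X \<times> Y"
    using g row by (intro incident_summable) auto
  have "(\<lambda>p. norm (case p of (x, y) \<Rightarrow> M x y * f y * cnj (g x))) summable_on X \<times> Y"
  proof (rule Infinite_Sum.abs_summable_on_comparison_test'[OF summable_on_add[OF 1 2]])
    fix p assume "p \<in> X \<times> Y"
    obtain x y where p: "p = (x, y)" by (cases p)
    have "cmod (M x y) * cmod (f y) * cmod (g x) \<le> cmod (f y) * cmod (g x)"
      using norm_le_1[of x y] by (simp add: mult_left_le_one_le mult_right_mono)
    also have "\<dots> \<le> (cmod (f y))\<^sup>2 + (cmod (g x))\<^sup>2"
      using sum_squares_bound[of "cmod (f y)" "cmod (g x)"]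
        mult_nonneg_nonneg[OF norm_ge_zero[of "f y"] norm_ge_zero[of "g x"]]
      unfolding mult.assoc by linarith
    finally show "norm (case p of (x, y) \<Rightarrow> M x y * f y * cnj (g x)) \<le>
        (case p of (x, y) \<Rightarrow> if M x y \<noteq> 0 then (cmod (f y))\<^sup>2 else 0) +
        (case p of (x, y) \<Rightarrow> if M x y \<noteq> 0 then (cmod (g x))\<^sup>2 else 0)"
      by (auto simp: p norm_mult)
  qed
  then have "(\<lambda>(x, y). M x y * f y * cnj (g x)) summable_on X \<times> Y"
    by (rule Infinite_Sum.abs_summable_summable)
  then have "(\<Sum>\<^sub>\<infinity>x\<in>X. \<Sum>\<^sub>\<infinity>y\<in>Y. M x y * f y * cnj (g x)) =
             (\<Sum>\<^sub>\<infinity>y\<in>Y. \<Sum>\<^sub>\<infinity>x\<in>X. M x y * f y * cnj (g x))"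
    by (rule infsum_swap_banach)
  also have "\<dots> = (\<Sum>\<^sub>\<infinity>y\<in>Y. \<Sum>\<^sub>\<infinity>x\<in>X. f y * (M x y * cnj (g x)))"
    by (simp add: mult_ac)
  finally show ?thesis
    by (simp only: infsum_cmult_left' infsum_cmult_right')
qed

end

section \<open>Cochains and Laplacians\<close>

locale std_complex =
  fixes V :: "'v set" and S :: "'v set set"
  assumes standing: "standing_assumptions V S"
begin

section \<open>Faces and cofaces of unoriented simplices\<close>

definition faces :: "nat \<Rightarrow> 'v set \<Rightarrow> 'v set set" where
  "faces q F = {G \<in> q_simplices S q. G \<subseteq> F}"

definition cofaces :: "nat \<Rightarrow> 'v set \<Rightarrow> 'v set set" where
  "cofaces q G = {F \<in> q_simplices S (q + 1). G \<subseteq> F}"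

lemma simplicial: "simplicial_complex V S"
  using standing by (simp add: standing_assumptions_def)

lemma q_simplicesD:
  assumes "F \<in> q_simplices S q"
  shows "F \<in> S" "finite F" "F \<noteq> {}" "card F = Suc q"
  using assms simplicial by (auto simp: q_simplices_def simplicial_complex_def)

lemma subset_q_simplices:
  assumes "F \<in> q_simplices S p" "G \<subseteq> F" "card G = Suc q"
  shows "G \<in> q_simplices S q"
  using assms simplicial unfolding q_simplices_def simplicial_complex_def by auto

lemma finite_faces: "F \<in> q_simplices S (q + 1) \<Longrightarrow> finite (faces q F)"
  by (rule finite_subset[of _ "Pow F"]) (auto simp: faces_def dest: q_simplicesD)

lemma card_faces_le:
  assumes "F \<in> q_simplices S (q + 1)"
  shows "card (faces q F) \<le> 2 ^ (q + 2)"
proof -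
  have "card (faces q F) \<le> card (Pow F)"
    using q_simplicesD[OF assms] by (intro card_mono) (auto simp: faces_def)
  then show ?thesis using q_simplicesD[OF assms] by (simp add: card_Pow)
qed

text \<open>Downward closure makes every subset omitting one of the \<open>q + 2\<close> vertices a
  face. This count becomes the diagonal entry of the down Laplacian.\<close>

lemma card_faces:
  assumes "F \<in> q_simplices S (q + 1)"
  shows "card (faces q F) = q + 2"
proof -
  have "faces q F = {G. G \<subseteq> F \<and> card G = Suc q}"
    unfolding faces_def using subset_q_simplices[OF assms] q_simplicesD(4) by blast
  then show ?thesis
    using q_simplicesD[OF assms] n_subsets[of F "Suc q"] binomial_Suc_n[of "Suc q"]
    by (simp del: binomial_Suc_Suc)
qed

text \<open>Bounded degree supplies one constant for all nonempty simplices at once, hence a bound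
  uniform also in the dimension.\<close>

lemma cofaces_bounded:
  obtains c where "\<And>q G. G \<in> q_simplices S q \<Longrightarrow> finite (cofaces q G) \<and> card (cofaces q G) \<le> c"
proof -
  obtain c where c: "\<And>G. G \<in> S \<Longrightarrow> G \<noteq> {} \<Longrightarrow> finite {H \<in> S. G \<subseteq> H} \<and> card {H \<in> S. G \<subseteq> H} \<le> c"
    using standing by (auto simp: standing_assumptions_def bounded_degree_def)
  have "finite (cofaces q G) \<and> card (cofaces q G) \<le> c" if "G \<in> q_simplices S q" for q G
  proof -
    have sub: "cofaces q G \<subseteq> {H \<in> S. G \<subseteq> H}"
      by (auto simp: cofaces_def dest: q_simplicesD)
    have "finite {H \<in> S. G \<subseteq> H}" "card {H \<in> S. G \<subseteq> H} \<le> c"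
      using c q_simplicesD[OF that] by auto
    then show ?thesis
      using sub by (meson card_mono finite_subset le_trans)
  qed
  then show ?thesis using that by blast
qed

lemma finite_cofaces: "G \<in> q_simplices S q \<Longrightarrow> finite (cofaces q G)"
  using cofaces_bounded by metis

section \<open>Oriented simplices as signed simplices\<close>

lemma osimplicesE:
  assumes "\<tau> \<in> osimplices S q"
  obtains F e where "F \<in> q_simplices S q" "e \<in> {1, -1}" "\<tau> = oriented F e"
  using assms unfolding osimplices_eq[OF simplicial] by (elim imageE SigmaE) auto

lemma oriented_in_osimplices:
  "F \<in> q_simplices S q \<Longrightarrow> e \<in> {1, -1} \<Longrightarrow> oriented F e \<in> osimplices S q"
  unfolding osimplices_eq[OF simplicial] by (intro image_eqI[of _ _ "(F, e)"]) auto

lemma inj_on_oriented: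
  "inj_on (\<lambda>(F, e). oriented F e) (q_simplices S q \<times> {1, -1})"
proof (rule inj_onI)
  fix p p' assume p: "p \<in> q_simplices S q \<times> {1, -1}" and p': "p' \<in> q_simplices S q \<times> {1, -1}"
    and eq: "(\<lambda>(F, e). oriented F e) p = (\<lambda>(F, e). oriented F e) p'"
  obtain F e G d where FG: "p = (F, e)" "p' = (G, d)" by (cases p, cases p')
  then have "oriented F e = oriented G d" "F \<in> q_simplices S q" "e \<in> {1, -1}"
    "G \<in> q_simplices S q" "d \<in> {1, -1}"
    using p p' eq by simp_all
  then show "p = p'"
    using oriented_inject q_simplicesD FG by metis
qed

lemma underlying_oriented_q:
  "F \<in> q_simplices S q \<Longrightarrow> e \<in> {1, -1} \<Longrightarrow> underlying (oriented F e) = F"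
  by (intro underlying_oriented) (auto dest: q_simplicesD)

lemma opposite_oriented_q:
  "F \<in> q_simplices S q \<Longrightarrow> e \<in> {1, -1} \<Longrightarrow> opposite (oriented F e) = oriented F (- e)"
  by (intro opposite_oriented) (auto dest: q_simplicesD)

lemma incidence_sgn_q:
  assumes "F \<in> q_simplices S (q + 1)" "G \<in> q_simplices S q" "e \<in> {1, -1}" "d \<in> {1, -1}"
  shows "incidence_sgn (oriented F e) (oriented G d) = (if G \<subseteq> F then e * d * face_sgn F G else 0)"
  using assms q_simplicesD[OF assms(1)] q_simplicesD[OF assms(2)]
  by (intro incidence_sgn_oriented) auto

lemma cochain_oriented:
  assumes "f \<in> cochains S q" "F \<in> q_simplices S q" "e \<in> {1, -1}"
  shows "f (oriented F e) = of_int e * f (oriented F 1)"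
proof -
  have "f (opposite (oriented F 1)) = - f (oriented F 1)"
    using assms oriented_in_osimplices[OF assms(2), of 1] by (auto simp: cochains_def)
  then show ?thesis using assms by (auto simp: opposite_oriented_q[OF assms(2)])
qed

lemma osimplices_over:
  assumes "A \<subseteq> q_simplices S q"
  shows "{\<tau> \<in> osimplices S q. underlying \<tau> \<in> A} = (\<lambda>(F, e). oriented F e) ` (A \<times> {1, -1})"
proof (intro equalityI subsetI)
  fix \<tau> assume "\<tau> \<in> {\<tau> \<in> osimplices S q. underlying \<tau> \<in> A}"
  then obtain F e where "F \<in> q_simplices S q" "e \<in> {1, -1}" "\<tau> = oriented F e" "underlying \<tau> \<in> A"
    by (blast elim: osimplicesE)
  then show "\<tau> \<in> (\<lambda>(F, e). oriented F e) ` (A \<times> {1, -1})"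
    by (intro image_eqI[of _ _ "(F, e)"]) (auto simp: underlying_oriented_q)
next
  fix \<tau> assume "\<tau> \<in> (\<lambda>(F, e). oriented F e) ` (A \<times> {1, -1})"
  then obtain F e where "F \<in> A" "e \<in> {1, -1}" "\<tau> = oriented F e"
    by (elim imageE SigmaE) auto
  with assms show "\<tau> \<in> {\<tau> \<in> osimplices S q. underlying \<tau> \<in> A}"
    by (auto simp: underlying_oriented_q intro!: oriented_in_osimplices)
qed

text \<open>The bridge from oriented to unoriented sums: each simplex contributes its two
  orientations, distinct by injectivity of \<open>oriented\<close>, and finiteness of
  \<open>A\<close> turns the infinite sum into a finite one.\<close>

lemma infsum_osimplices_over:
  fixes h :: "'v osimplex \<Rightarrow> complex"
  assumes "finite A" "A \<subseteq> q_simplices S q"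
  shows "(\<Sum>\<^sub>\<infinity>\<tau>\<in>{\<tau> \<in> osimplices S q. underlying \<tau> \<in> A}. h \<tau>) =
           (\<Sum>F\<in>A. h (oriented F 1) + h (oriented F (-1)))"
proof -
  have "inj_on (\<lambda>(F, e). oriented F e) (A \<times> {1, -1})"
    using inj_on_oriented by (rule inj_on_subset) (use assms in auto)
  then have "(\<Sum>\<^sub>\<infinity>\<tau>\<in>{\<tau> \<in> osimplices S q. underlying \<tau> \<in> A}. h \<tau>) =
        (\<Sum>(F, e)\<in>A \<times> {1, -1}. h (oriented F e))"
    using assms by (simp only: osimplices_over infsum_finite finite_imageI finite_cartesian_product
        finite.intros sum.reindex o_def) (simp add: case_prod_beta)
  also have "\<dots> = (\<Sum>F\<in>A. h (oriented F 1) + h (oriented F (-1)))"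
    using assms by (simp add: sum.cartesian_product[symmetric])
  finally show ?thesis .
qed

lemma infsum_osimplices:
  fixes h :: "'v osimplex \<Rightarrow> complex"
  assumes "finite A" "A \<subseteq> q_simplices S q"
    and "\<And>F e. F \<in> q_simplices S q \<Longrightarrow> F \<notin> A \<Longrightarrow> e \<in> {1, -1} \<Longrightarrow> h (oriented F e) = 0"
  shows "(\<Sum>\<^sub>\<infinity>\<tau>\<in>osimplices S q. h \<tau>) = (\<Sum>F\<in>A. h (oriented F 1) + h (oriented F (-1)))"
proof -
  have "(\<Sum>\<^sub>\<infinity>\<tau>\<in>osimplices S q. h \<tau>) =
          (\<Sum>\<^sub>\<infinity>\<tau>\<in>{\<tau> \<in> osimplices S q. underlying \<tau> \<in> A}. h \<tau>)"
  proof (rule infsum_cong_neutral)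
    fix \<tau> assume \<tau>: "\<tau> \<in> osimplices S q - {\<tau> \<in> osimplices S q. underlying \<tau> \<in> A}"
    then obtain F e where "F \<in> q_simplices S q" "e \<in> {1, -1}" "\<tau> = oriented F e"
      by (blast elim: osimplicesE)
    with \<tau> assms(3) show "h \<tau> = 0" by (auto simp: underlying_oriented_q)
  qed auto
  then show ?thesis using assms by (simp add: infsum_osimplices_over)
qed

section \<open>The coboundary and the transposed incidence sum\<close>

lemma coboundary_oriented:
  assumes f: "f \<in> cochains S q" and F: "F \<in> q_simplices S (q + 1)" and e: "e \<in> {1, -1}"
  shows "coboundary S q f (oriented F e) =
           of_int e * (\<Sum>G\<in>faces q F. of_int (face_sgn F G) * f (oriented G 1))"
proof -
  let ?h = "\<lambda>\<tau>. of_int (incidence_sgn (oriented F e) \<tau>) * f \<tau>"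
  have "(\<Sum>\<^sub>\<infinity>\<tau>\<in>osimplices S q. ?h \<tau>) = (\<Sum>G\<in>faces q F. ?h (oriented G 1) + ?h (oriented G (-1)))"
    using F e by (intro infsum_osimplices finite_faces) (auto simp: faces_def incidence_sgn_q)
  \<comment> \<open>Reversing \<open>G\<close> changes both the incidence number and the cochain
    value, so the two orientations contribute equally; their factor 2 cancels the 1/2 in
    \<open>coboundary\<close>.\<close>
  also have "\<dots> = (\<Sum>G\<in>faces q F. 2 * of_int e * (of_int (face_sgn F G) * f (oriented G 1)))"
  proof (rule sum.cong)
    fix G assume "G \<in> faces q F"
    then have G: "G \<in> q_simplices S q" "G \<subseteq> F" by (auto simp: faces_def)
    show "?h (oriented G 1) + ?h (oriented G (-1)) =
            2 * of_int e * (of_int (face_sgn F G) * f (oriented G 1))"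
      using G F e cochain_oriented[OF f G(1), of "-1"] by (simp add: incidence_sgn_q)
  qed simp
  finally show ?thesis
    using oriented_in_osimplices[OF F e]
    by (simp add: coboundary_def sum_distrib_left[symmetric] mult.assoc)
qed

text \<open>The transposed incidence matrix with the same factor 1/2: an explicit candidate for the
  adjoint, which \<open>coboundary_adj\<close> only describes.\<close>

definition boundary :: "nat \<Rightarrow> ('v osimplex \<Rightarrow> complex) \<Rightarrow> 'v osimplex \<Rightarrow> complex" where
  "boundary q g = (\<lambda>\<tau>. if \<tau> \<in> osimplices S q
     then 1 / 2 * (\<Sum>\<^sub>\<infinity>\<sigma>\<in>osimplices S (q + 1). of_int (incidence_sgn \<sigma> \<tau>) * g \<sigma>)
     else 0)"

lemma boundary_oriented:
  assumes g: "g \<in> cochains S (q + 1)" and G: "G \<in> q_simplices S q" and d: "d \<in> {1, -1}"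
  shows "boundary q g (oriented G d) =
           of_int d * (\<Sum>F\<in>cofaces q G. of_int (face_sgn F G) * g (oriented F 1))"
proof -
  let ?h = "\<lambda>\<sigma>. of_int (incidence_sgn \<sigma> (oriented G d)) * g \<sigma>"
  have "(\<Sum>\<^sub>\<infinity>\<sigma>\<in>osimplices S (q + 1). ?h \<sigma>) =
          (\<Sum>F\<in>cofaces q G. ?h (oriented F 1) + ?h (oriented F (-1)))"
    using G d by (intro infsum_osimplices finite_cofaces) (auto simp: cofaces_def incidence_sgn_q)
  also have "\<dots> = (\<Sum>F\<in>cofaces q G. 2 * of_int d * (of_int (face_sgn F G) * g (oriented F 1)))"
  proof (rule sum.cong)
    fix F assume "F \<in> cofaces q G"
    then have F: "F \<in> q_simplices S (q + 1)" "G \<subseteq> F" by (auto simp: cofaces_def)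
    show "?h (oriented F 1) + ?h (oriented F (-1)) =
            2 * of_int d * (of_int (face_sgn F G) * g (oriented F 1))"
      using F G d cochain_oriented[OF g F(1), of "-1"]
      by (simp add: incidence_sgn_q[OF F(1) G _ d])
  qed simp
  finally show ?thesis
    using oriented_in_osimplices[OF G d]
    by (simp add: boundary_def sum_distrib_left[symmetric] mult.assoc)
qed

text \<open>Padding with zeros makes the entry bound of \<open>bounded_incidence\<close> hold for
  all arguments, including those where \<open>incidence_sgn\<close> has no controlled value.\<close>

definition incid :: "nat \<Rightarrow> 'v osimplex \<Rightarrow> 'v osimplex \<Rightarrow> complex" where
  "incid q \<sigma> \<tau> = (if \<sigma> \<in> osimplices S (q + 1) \<and> \<tau> \<in> osimplices S q
                  then of_int (incidence_sgn \<sigma> \<tau>) else 0)"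

lemma incidence_bounded:
  obtains r c where "bounded_incidence (osimplices S (q + 1)) (osimplices S q) (incid q) r c"
proof -
  obtain c where c: "\<And>q G. G \<in> q_simplices S q \<Longrightarrow> finite (cofaces q G) \<and> card (cofaces q G) \<le> c"
    using cofaces_bounded by blast
  have over: "finite {\<tau> \<in> osimplices S p. underlying \<tau> \<in> A} \<and>
              card {\<tau> \<in> osimplices S p. underlying \<tau> \<in> A} \<le> n * 2"
    if A: "A \<subseteq> q_simplices S p" "finite A" "card A \<le> n" for A p n
  proof -
    have "card {\<tau> \<in> osimplices S p. underlying \<tau> \<in> A} \<le> card (A \<times> {1, -1 :: int})"
      unfolding osimplices_over[OF A(1)] using A by (intro card_image_le) simp
    also have "\<dots> \<le> n * 2" using A by (simp add: card_cartesian_product)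
    finally show ?thesis using A by (simp add: osimplices_over)
  qed
  have sub: "finite B \<and> card B \<le> n" if "B \<subseteq> C" "finite C \<and> card C \<le> n"
    for B C :: "'v osimplex set" and n
    using that by (meson card_mono finite_subset le_trans)
  \<comment> \<open>A row meets at most \<open>2 ^ (q + 2)\<close> faces and a column at most
    \<open>c\<close> cofaces; each bound is doubled by the two orientations.\<close>
  have "bounded_incidence (osimplices S (q + 1)) (osimplices S q) (incid q) (2 ^ (q + 2) * 2) (c * 2)"
  proof
    fix \<sigma> \<tau>
    show "cmod (incid q \<sigma> \<tau>) \<le> 1"
    proof (cases "\<sigma> \<in> osimplices S (q + 1) \<and> \<tau> \<in> osimplices S q")
      case True
      then obtain F e G d where F: "F \<in> q_simplices S (q + 1)" and e: "e \<in> {1, -1}" and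
        G: "G \<in> q_simplices S q" and d: "d \<in> {1, -1}" and
        eq: "\<sigma> = oriented F e" "\<tau> = oriented G d"
        by (blast elim: osimplicesE)
      have "\<bar>incidence_sgn \<sigma> \<tau>\<bar> \<le> 1"
        unfolding eq incidence_sgn_q[OF F G e d] using e d face_sgn_cases[of F G] by auto
      then show ?thesis using True by (simp add: incid_def flip: of_int_abs)
    qed (auto simp: incid_def)
  next
    fix \<sigma> assume \<sigma>: "\<sigma> \<in> osimplices S (q + 1)"
    then obtain F e where F: "F \<in> q_simplices S (q + 1)" "e \<in> {1, -1}" "\<sigma> = oriented F e"
      by (blast elim: osimplicesE)
    have "{\<tau> \<in> osimplices S q. incid q \<sigma> \<tau> \<noteq> 0} \<subseteq> {\<tau> \<in> osimplices S q. underlying \<tau> \<in> faces q F}"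
    proof
      fix \<tau> assume \<tau>: "\<tau> \<in> {\<tau> \<in> osimplices S q. incid q \<sigma> \<tau> \<noteq> 0}"
      then obtain G d where G: "G \<in> q_simplices S q" "d \<in> {1, -1}" "\<tau> = oriented G d"
        by (blast elim: osimplicesE)
      then show "\<tau> \<in> {\<tau> \<in> osimplices S q. underlying \<tau> \<in> faces q F}"
        using \<tau> F incidence_sgn_q[OF F(1) G(1) F(2) G(2)]
        by (auto simp: underlying_oriented_q faces_def incid_def split: if_splits)
    qed
    then show "finite {\<tau> \<in> osimplices S q. incid q \<sigma> \<tau> \<noteq> 0} \<and>
               card {\<tau> \<in> osimplices S q. incid q \<sigma> \<tau> \<noteq> 0} \<le> 2 ^ (q + 2) * 2"
      by (rule sub, intro over finite_faces card_faces_le F) (auto simp: faces_def)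
  next
    fix \<tau> assume \<tau>: "\<tau> \<in> osimplices S q"
    then obtain G d where G: "G \<in> q_simplices S q" "d \<in> {1, -1}" "\<tau> = oriented G d"
      by (blast elim: osimplicesE)
    have "{\<sigma> \<in> osimplices S (q + 1). incid q \<sigma> \<tau> \<noteq> 0} \<subseteq>
          {\<sigma> \<in> osimplices S (q + 1). underlying \<sigma> \<in> cofaces q G}"
    proof
      fix \<sigma> assume \<sigma>: "\<sigma> \<in> {\<sigma> \<in> osimplices S (q + 1). incid q \<sigma> \<tau> \<noteq> 0}"
      then obtain F e where F: "F \<in> q_simplices S (q + 1)" "e \<in> {1, -1}" "\<sigma> = oriented F e"
        by (blast elim: osimplicesE)
      then show "\<sigma> \<in> {\<sigma> \<in> osimplices S (q + 1). underlying \<sigma> \<in> cofaces q G}"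
        using \<sigma> G incidence_sgn_q[OF F(1) G(1) F(2) G(2)]
        by (auto simp: underlying_oriented_q cofaces_def incid_def split: if_splits)
    qed
    then show "finite {\<sigma> \<in> osimplices S (q + 1). incid q \<sigma> \<tau> \<noteq> 0} \<and>
               card {\<sigma> \<in> osimplices S (q + 1). incid q \<sigma> \<tau> \<noteq> 0} \<le> c * 2"
      by (rule sub, intro over) (use c[OF G(1)] in \<open>auto simp: cofaces_def\<close>)
  qed
  then show ?thesis using that by blast
qed

section \<open>Square summability and the adjoint of the coboundary\<close>

lemma cochainsI:
  assumes "\<And>\<tau>. \<tau> \<notin> osimplices S q \<Longrightarrow> f \<tau> = 0"
    and "(\<lambda>\<tau>. (cmod (f \<tau>))\<^sup>2) summable_on osimplices S q"
    and "\<And>F. F \<in> q_simplices S q \<Longrightarrow> f (oriented F (-1)) = - f (oriented F 1)"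
  shows "f \<in> cochains S q"
proof -
  have "f (opposite \<tau>) = - f \<tau>" if "\<tau> \<in> osimplices S q" for \<tau>
  proof -
    obtain F e where F: "F \<in> q_simplices S q" "e \<in> {1, -1}" "\<tau> = oriented F e"
      using \<open>\<tau> \<in> osimplices S q\<close> by (rule osimplicesE)
    then show ?thesis
      using assms(3)[OF F(1)] by (auto simp: opposite_oriented_q[OF F(1)])
  qed
  then show ?thesis using assms by (auto simp: cochains_def ell2_def)
qed

lemma cochains_summable:
  "f \<in> cochains S q \<Longrightarrow> (\<lambda>\<tau>. (cmod (f \<tau>))\<^sup>2) summable_on osimplices S q"
  by (simp add: cochains_def ell2_def)

lemma cochains_outside: "f \<in> cochains S q \<Longrightarrow> \<tau> \<notin> osimplices S q \<Longrightarrow> f \<tau> = 0"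
  by (simp add: cochains_def ell2_def)

lemma cmod_half_square: "(cmod (1 / 2 * z))\<^sup>2 = 1 / 4 * (cmod z)\<^sup>2"
  by (simp add: norm_mult power_mult_distrib power2_eq_square)

lemma coboundary_eq_incid:
  "coboundary S q f \<sigma> = 1 / 2 * (\<Sum>\<^sub>\<infinity>\<tau>\<in>osimplices S q. incid q \<sigma> \<tau> * f \<tau>)"
proof -
  have "(\<Sum>\<^sub>\<infinity>\<tau>\<in>osimplices S q. incid q \<sigma> \<tau> * f \<tau>) = (if \<sigma> \<in> osimplices S (q + 1)
          then \<Sum>\<^sub>\<infinity>\<tau>\<in>osimplices S q. of_int (incidence_sgn \<sigma> \<tau>) * f \<tau> else 0)"
    by (auto simp: incid_def intro!: infsum_cong infsum_0)
  then show ?thesis by (simp add: coboundary_def)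
qed

lemma boundary_eq_incid:
  "boundary q g \<tau> = 1 / 2 * (\<Sum>\<^sub>\<infinity>\<sigma>\<in>osimplices S (q + 1). incid q \<sigma> \<tau> * g \<sigma>)"
proof -
  have "(\<Sum>\<^sub>\<infinity>\<sigma>\<in>osimplices S (q + 1). incid q \<sigma> \<tau> * g \<sigma>) = (if \<tau> \<in> osimplices S q
          then \<Sum>\<^sub>\<infinity>\<sigma>\<in>osimplices S (q + 1). of_int (incidence_sgn \<sigma> \<tau>) * g \<sigma> else 0)"
    by (auto simp: incid_def intro!: infsum_cong infsum_0)
  then show ?thesis by (simp add: boundary_def)
qed

lemma coboundary_in_cochains:
  assumes f: "f \<in> cochains S q"
  shows "coboundary S q f \<in> cochains S (q + 1)"
proof (rule cochainsI)
  obtain r c where "bounded_incidence (osimplices S (q + 1)) (osimplices S q) (incid q) r c"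
    by (rule incidence_bounded)
  from bounded_incidence.summable_square[OF this cochains_summable[OF f]]
  show "(\<lambda>\<sigma>. (cmod (coboundary S q f \<sigma>))\<^sup>2) summable_on osimplices S (q + 1)"
    unfolding coboundary_eq_incid cmod_half_square by (rule summable_on_cmult_right)
qed (use f in \<open>simp_all add: coboundary_oriented\<close>, simp add: coboundary_def)

lemma boundary_in_cochains:
  assumes g: "g \<in> cochains S (q + 1)"
  shows "boundary q g \<in> cochains S q"
proof (rule cochainsI)
  obtain r c where "bounded_incidence (osimplices S (q + 1)) (osimplices S q) (incid q) r c"
    by (rule incidence_bounded)
  from bounded_incidence.summable_square[OF bounded_incidence.transposed[OF this] cochains_summable[OF g]]
  show "(\<lambda>\<tau>. (cmod (boundary q g \<tau>))\<^sup>2) summable_on osimplices S q"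
    unfolding boundary_eq_incid cmod_half_square by (rule summable_on_cmult_right)
qed (use g in \<open>simp_all add: boundary_oriented\<close>, simp add: boundary_def)

lemma coboundary_boundary_adjoint:
  assumes f: "f \<in> cochains S q" and g: "g \<in> cochains S (q + 1)"
  shows "ell2_inner S (q + 1) (coboundary S q f) g = ell2_inner S q f (boundary q g)"
proof -
  let ?X = "osimplices S (q + 1)" and ?Y = "osimplices S q"
  obtain r c where "bounded_incidence ?X ?Y (incid q) r c"
    by (rule incidence_bounded)
  note adj = bounded_incidence.infsum_adjoint[OF this cochains_summable[OF f] cochains_summable[OF g]]
  \<comment> \<open>Incidence numbers are real, so the conjugation in the inner product passes
    through them to \<open>g\<close>.\<close>
  have cnj_incid: "cnj (incid q \<sigma> \<tau>) = incid q \<sigma> \<tau>" for \<sigma> \<tau>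
    by (simp add: incid_def)
  have "ell2_inner S (q + 1) (coboundary S q f) g =
          (\<Sum>\<^sub>\<infinity>\<sigma>\<in>?X. 1 / 2 * ((\<Sum>\<^sub>\<infinity>\<tau>\<in>?Y. incid q \<sigma> \<tau> * f \<tau>) * cnj (g \<sigma>)))"
    by (simp add: ell2_inner_def coboundary_eq_incid)
  also have "\<dots> = 1 / 2 * (\<Sum>\<^sub>\<infinity>\<sigma>\<in>?X. (\<Sum>\<^sub>\<infinity>\<tau>\<in>?Y. incid q \<sigma> \<tau> * f \<tau>) * cnj (g \<sigma>))"
    by (rule infsum_cmult_right')
  also have "\<dots> = (\<Sum>\<^sub>\<infinity>\<tau>\<in>?Y. 1 / 2 * (f \<tau> * (\<Sum>\<^sub>\<infinity>\<sigma>\<in>?X. incid q \<sigma> \<tau> * cnj (g \<sigma>))))"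
    unfolding adj by (rule infsum_cmult_right'[symmetric])
  also have "\<dots> = ell2_inner S q f (boundary q g)"
    by (simp add: ell2_inner_def boundary_eq_incid cnj_incid flip: infsum_cnj)
  finally show ?thesis .
qed

text \<open>Testing against the cochains supported on a single simplex reads off every value. This
  is the uniqueness part of the adjoint.\<close>

lemma cochain_eqI:
  assumes h: "h \<in> cochains S q" and h': "h' \<in> cochains S q"
    and inner: "\<And>f. f \<in> cochains S q \<Longrightarrow> ell2_inner S q f h = ell2_inner S q f h'"
  shows "h = h'"
proof -
  have eq: "h (oriented F 1) = h' (oriented F 1)" if F: "F \<in> q_simplices S q" for F
  proof -
    define f :: "'v osimplex \<Rightarrow> complex" where
      "f = (\<lambda>\<tau>. if \<tau> = oriented F 1 then 1 else if \<tau> = oriented F (-1) then -1 else 0)"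
    have inject: "oriented G e = oriented F d \<longleftrightarrow> G = F \<and> e = d"
      if "G \<in> q_simplices S q" "e \<in> {1, -1}" "d \<in> {1, -1}" for G e d
      using that F by (intro oriented_inject) (auto dest: q_simplicesD)
    have "f \<in> cochains S q"
    proof (rule cochainsI)
      have "(\<lambda>\<tau>. (cmod (f \<tau>))\<^sup>2) summable_on {oriented F 1, oriented F (-1)}"
        by simp
      also have "?this \<longleftrightarrow> (\<lambda>\<tau>. (cmod (f \<tau>))\<^sup>2) summable_on osimplices S q"
        using oriented_in_osimplices[OF F]
        by (intro summable_on_cong_neutral) (auto simp: f_def)
      finally show "(\<lambda>\<tau>. (cmod (f \<tau>))\<^sup>2) summable_on osimplices S q" .
    next
      fix G assume "G \<in> q_simplices S q"
      then show "f (oriented G (-1)) = - f (oriented G 1)"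
        by (simp add: f_def inject)
    qed (use oriented_in_osimplices[OF F] in \<open>auto simp: f_def\<close>)
    \<comment> \<open>The value -1 of \<open>f\<close> on the reversed simplex is forced by
      antisymmetry; both orientations then contribute equally, hence the factor 2.\<close>
    moreover have "ell2_inner S q f k = 2 * cnj (k (oriented F 1))" if k: "k \<in> cochains S q" for k
    proof -
      have "ell2_inner S q f k = (\<Sum>G\<in>{F}. f (oriented G 1) * cnj (k (oriented G 1)) +
              f (oriented G (-1)) * cnj (k (oriented G (-1))))"
        unfolding ell2_inner_def using F
        by (intro infsum_osimplices) (auto simp: f_def inject)
      then show ?thesis
        using cochain_oriented[OF k F, of "-1"] by (simp add: f_def inject F)
    qed
    ultimately show ?thesis using inner[of f] h h' by simp
  qed
  show ?thesis
  proof
    fix \<tau> show "h \<tau> = h' \<tau>"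
    proof (cases "\<tau> \<in> osimplices S q")
      case True
      then obtain F e where "F \<in> q_simplices S q" "e \<in> {1, -1}" "\<tau> = oriented F e"
        by (rule osimplicesE)
      then show ?thesis
        using eq cochain_oriented[OF h] cochain_oriented[OF h'] by metis
    qed (use h h' in \<open>simp add: cochains_outside\<close>)
  qed
qed

text \<open>The adjointness identity provides existence and \<open>cochain_eqI\<close> uniqueness
  for the definite description.\<close>

lemma coboundary_adj_eq_boundary:
  assumes g: "g \<in> cochains S (q + 1)"
  shows "coboundary_adj S q g = boundary q g"
  unfolding coboundary_adj_def
proof (rule the_equality)
  show "boundary q g \<in> cochains S q \<and> (\<forall>f\<in>cochains S q.
          ell2_inner S (q + 1) (coboundary S q f) g = ell2_inner S q f (boundary q g))"
    using g coboundary_boundary_adjoint boundary_in_cochains by blast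
next
  fix h assume "h \<in> cochains S q \<and> (\<forall>f\<in>cochains S q.
          ell2_inner S (q + 1) (coboundary S q f) g = ell2_inner S q f h)"
  then show "h = boundary q g"
    using cochain_eqI[OF _ boundary_in_cochains[OF g], of h] coboundary_boundary_adjoint[OF _ g]
    by simp
qed

section \<open>Laplacians as finite double sums\<close>

lemma laplacian_up_oriented:
  assumes f: "f \<in> cochains S q" and G: "G \<in> q_simplices S q" and d: "d \<in> {1, -1}"
  shows "laplacian_up S q f (oriented G d) = of_int d *
           (\<Sum>F\<in>cofaces q G. of_int (face_sgn F G) *
             (\<Sum>G'\<in>faces q F. of_int (face_sgn F G') * f (oriented G' 1)))"
  unfolding laplacian_up_def coboundary_adj_eq_boundary[OF coboundary_in_cochains[OF f]]
    boundary_oriented[OF coboundary_in_cochains[OF f] G d]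
  using f by (intro arg_cong2[where f = "(*)"] sum.cong) (auto simp: coboundary_oriented cofaces_def)

text \<open>Indexing by \<open>q + 1\<close> resolves the truncated subtraction in the definition of
  \<open>laplacian_down\<close>.\<close>

lemma laplacian_down_oriented:
  assumes f: "f \<in> cochains S (q + 1)" and F: "F \<in> q_simplices S (q + 1)" and e: "e \<in> {1, -1}"
  shows "laplacian_down S (q + 1) f (oriented F e) = of_int e *
           (\<Sum>G\<in>faces q F. of_int (face_sgn F G) *
             (\<Sum>F'\<in>cofaces q G. of_int (face_sgn F' G) * f (oriented F' 1)))"
  unfolding laplacian_down_def add_diff_cancel_right' coboundary_adj_eq_boundary[OF f]
    coboundary_oriented[OF boundary_in_cochains[OF f] F e]
  using f by (intro arg_cong2[where f = "(*)"] sum.cong) (auto simp: boundary_oriented faces_def)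

end


section \<open>Discriminants\<close>

context std_complex
begin

text \<open>Two distinct simplices of equal size have a union with at least one more vertex, that is
  at least \<open>q + 2\<close>; a common coface has exactly that many, so the union fills
  it.\<close>

lemma up_neighbors_union:
  assumes "up_neighbors S q G G'"
  shows "G \<union> G' \<in> q_simplices S (q + 1)"
    and "H \<in> q_simplices S (q + 1) \<Longrightarrow> G \<subseteq> H \<Longrightarrow> G' \<subseteq> H \<Longrightarrow> H = G \<union> G'"
proof -
  have G: "G \<in> q_simplices S q" "G' \<in> q_simplices S q" "G \<noteq> G'"
    using assms by (auto simp: up_neighbors_def)
  note D = q_simplicesD[OF G(1)] q_simplicesD[OF G(2)]
  have *: "H = G \<union> G'" if H: "H \<in> q_simplices S (q + 1)" "G \<subseteq> H" "G' \<subseteq> H" for H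
  proof -
    have "G \<subset> G \<union> G'" using D G(3) card_subset_eq[of G G'] by auto
    then have "card G < card (G \<union> G')" using D by (intro psubset_card_mono) auto
    then have "card H \<le> card (G \<union> G')" using D q_simplicesD[OF H(1)] by simp
    then show ?thesis
      using H q_simplicesD[OF H(1)] card_seteq[of H "G \<union> G'"] by auto
  qed
  then show "H \<in> q_simplices S (q + 1) \<Longrightarrow> G \<subseteq> H \<Longrightarrow> G' \<subseteq> H \<Longrightarrow> H = G \<union> G'" .
  obtain H where "H \<in> q_simplices S (q + 1)" "G \<subseteq> H" "G' \<subseteq> H"
    using assms by (auto simp: up_neighbors_def)
  with * show "G \<union> G' \<in> q_simplices S (q + 1)" by metis
qed

text \<open>Two distinct simplices of dimension \<open>q + 1\<close> share at most
  \<open>q + 1\<close> vertices, and a common face of dimension \<open>q\<close> already has that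
  many.\<close>

lemma common_face_eq_inter:
  assumes "F \<in> q_simplices S (q + 1)" "F' \<in> q_simplices S (q + 1)" "F \<noteq> F'"
    and "G \<in> q_simplices S q" "G \<subseteq> F" "G \<subseteq> F'"
  shows "G = F \<inter> F'"
proof -
  note D = q_simplicesD[OF assms(1)] q_simplicesD[OF assms(2)] q_simplicesD[OF assms(4)]
  have "F \<inter> F' \<subset> F" using D assms(3) card_subset_eq[of F' F] by auto
  then have "card (F \<inter> F') < card F" using D by (intro psubset_card_mono) auto
  then have "card (F \<inter> F') \<le> card G" using D by simp
  then show ?thesis using assms D card_seteq[of "F \<inter> F'" G] by auto
qed

text \<open>Splitting off \<open>G' = G\<close> gives \<open>\<phi> G\<close> once per coface, since
  a face sign squares to 1. The remaining pairs \<open>(F, G')\<close> correspond to the up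
  neighbors \<open>G'\<close>, because \<open>F\<close> must be the union.\<close>

lemma sum_cofaces_faces:
  fixes \<phi> :: "'v set \<Rightarrow> complex"
  assumes G: "G \<in> q_simplices S q"
  shows "(\<Sum>F\<in>cofaces q G. of_int (face_sgn F G) * (\<Sum>G'\<in>faces q F. of_int (face_sgn F G') * \<phi> G')) =
           of_nat (card (cofaces q G)) * \<phi> G +
           (\<Sum>G' | up_neighbors S q G' G.
              of_int (face_sgn (G \<union> G') G * face_sgn (G \<union> G') G') * \<phi> G')"
proof -
  let ?t = "\<lambda>F G'. of_int (face_sgn F G * face_sgn F G') * \<phi> G'"
  have "(\<Sum>F\<in>cofaces q G. of_int (face_sgn F G) * (\<Sum>G'\<in>faces q F. of_int (face_sgn F G') * \<phi> G')) =
          (\<Sum>F\<in>cofaces q G. \<phi> G + (\<Sum>G'\<in>faces q F - {G}. ?t F G'))"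
  proof (rule sum.cong)
    fix F assume F: "F \<in> cofaces q G"
    then have "G \<in> faces q F" "finite (faces q F)"
      using G finite_faces[of F q] by (simp_all add: cofaces_def faces_def)
    moreover have "of_int (face_sgn F G) * (of_int (face_sgn F G) * \<phi> G) = \<phi> G"
      by (simp only: face_sgn_square of_int_1 mult_1 flip: mult.assoc of_int_mult)
    ultimately show "of_int (face_sgn F G) * (\<Sum>G'\<in>faces q F. of_int (face_sgn F G') * \<phi> G') =
            \<phi> G + (\<Sum>G'\<in>faces q F - {G}. ?t F G')"
      by (simp add: sum.remove sum_distrib_left distrib_left mult.assoc)
  qed simp
  also have "\<dots> = of_nat (card (cofaces q G)) * \<phi> G + (\<Sum>F\<in>cofaces q G. \<Sum>G'\<in>faces q F - {G}. ?t F G')"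
    by (simp add: sum.distrib)
  also have "(\<Sum>F\<in>cofaces q G. \<Sum>G'\<in>faces q F - {G}. ?t F G') =
        (\<Sum>(F, G')\<in>(SIGMA F:cofaces q G. faces q F - {G}). ?t F G')"
    using G by (intro sum.Sigma finite_cofaces ballI) (auto simp: cofaces_def intro: finite_faces)
  also have "\<dots> = (\<Sum>G' | up_neighbors S q G' G. ?t (G \<union> G') G')"
  proof (rule sum.reindex_bij_witness[of _ "\<lambda>G'. (G \<union> G', G')" snd])
    fix p assume p: "p \<in> (SIGMA F:cofaces q G. faces q F - {G})"
    then obtain F G' where FG: "p = (F, G')" "F \<in> q_simplices S (q + 1)" "G \<subseteq> F"
      "G' \<in> q_simplices S q" "G' \<subseteq> F" "G' \<noteq> G"
      by (auto simp: cofaces_def faces_def)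
    then have nb: "up_neighbors S q G' G"
      using G by (auto simp: up_neighbors_def)
    then show "snd p \<in> {G'. up_neighbors S q G' G}" by (simp add: FG)
    have "F = G \<union> G'" using up_neighbors_union(2)[OF nb] FG by blast
    then show "(G \<union> snd p, snd p) = p" "?t (G \<union> snd p) (snd p) = (case p of (F, G') \<Rightarrow> ?t F G')"
      by (simp_all add: FG)
  next
    fix G' assume "G' \<in> {G'. up_neighbors S q G' G}"
    then have nb: "up_neighbors S q G' G" by simp
    then show "(G \<union> G', G') \<in> (SIGMA F:cofaces q G. faces q F - {G})"
      using up_neighbors_union(1)[OF nb]
      by (auto simp: cofaces_def faces_def up_neighbors_def Un_commute)
  qed simp
  finally show ?thesis .
qed

text \<open>The diagonal term occurs once for each of the \<open>q + 2\<close> faces of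
  \<open>F\<close>. A pair \<open>(G, F')\<close> with \<open>F'\<close> different from
  \<open>F\<close> is fixed by \<open>F'\<close> alone, since \<open>G\<close> must be the
  intersection.\<close>

lemma sum_faces_cofaces:
  fixes \<phi> :: "'v set \<Rightarrow> complex"
  assumes F: "F \<in> q_simplices S (q + 1)"
  shows "(\<Sum>G\<in>faces q F. of_int (face_sgn F G) * (\<Sum>F'\<in>cofaces q G. of_int (face_sgn F' G) * \<phi> F')) =
           of_nat (q + 2) * \<phi> F +
           (\<Sum>F' | down_neighbors S (q + 1) F' F.
              of_int (face_sgn F (F \<inter> F') * face_sgn F' (F \<inter> F')) * \<phi> F')"
proof -
  let ?t = "\<lambda>G F'. of_int (face_sgn F G * face_sgn F' G) * \<phi> F'"
  have fin: "finite (cofaces q G)" if "G \<in> faces q F" for G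
    using that by (auto simp: faces_def intro: finite_cofaces)
  have "(\<Sum>G\<in>faces q F. of_int (face_sgn F G) * (\<Sum>F'\<in>cofaces q G. of_int (face_sgn F' G) * \<phi> F')) =
          (\<Sum>G\<in>faces q F. \<phi> F + (\<Sum>F'\<in>cofaces q G - {F}. ?t G F'))"
  proof (rule sum.cong)
    fix G assume G: "G \<in> faces q F"
    then have "F \<in> cofaces q G" "finite (cofaces q G)"
      using F fin[OF G] by (simp_all add: cofaces_def faces_def)
    moreover have "of_int (face_sgn F G) * (of_int (face_sgn F G) * \<phi> F) = \<phi> F"
      by (simp only: face_sgn_square of_int_1 mult_1 flip: mult.assoc of_int_mult)
    ultimately show "of_int (face_sgn F G) * (\<Sum>F'\<in>cofaces q G. of_int (face_sgn F' G) * \<phi> F') =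
            \<phi> F + (\<Sum>F'\<in>cofaces q G - {F}. ?t G F')"
      by (simp add: sum.remove sum_distrib_left distrib_left mult.assoc)
  qed simp
  also have "\<dots> = of_nat (q + 2) * \<phi> F + (\<Sum>G\<in>faces q F. \<Sum>F'\<in>cofaces q G - {F}. ?t G F')"
    using card_faces[OF F] by (simp add: sum.distrib)
  also have "(\<Sum>G\<in>faces q F. \<Sum>F'\<in>cofaces q G - {F}. ?t G F') =
        (\<Sum>(G, F')\<in>(SIGMA G:faces q F. cofaces q G - {F}). ?t G F')"
    using F fin by (intro sum.Sigma) (auto simp: finite_faces)
  also have "\<dots> = (\<Sum>F' | down_neighbors S (q + 1) F' F. ?t (F \<inter> F') F')"
  proof (rule sum.reindex_bij_witness[of _ "\<lambda>F'. (F \<inter> F', F')" snd])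
    fix p assume p: "p \<in> (SIGMA G:faces q F. cofaces q G - {F})"
    then obtain G F' where FG: "p = (G, F')" "F' \<in> q_simplices S (q + 1)" "G \<subseteq> F"
      "G \<in> q_simplices S q" "G \<subseteq> F'" "F' \<noteq> F"
      by (auto simp: cofaces_def faces_def)
    then have eq: "G = F \<inter> F'"
      using common_face_eq_inter[OF F] by metis
    show "snd p \<in> {F'. down_neighbors S (q + 1) F' F}"
      using F FG eq by (auto simp: down_neighbors_def Int_commute)
    show "(F \<inter> snd p, snd p) = p" "?t (F \<inter> snd p) (snd p) = (case p of (G, F') \<Rightarrow> ?t G F')"
      using eq by (simp_all add: FG)
  next
    fix F' assume "F' \<in> {F'. down_neighbors S (q + 1) F' F}"
    then show "(F \<inter> F', F') \<in> (SIGMA G:faces q F. cofaces q G - {F})"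
      by (auto simp: cofaces_def faces_def down_neighbors_def Int_commute)
  qed simp
  finally show ?thesis .
qed

lemma finite_up_neighbors:
  assumes G: "G \<in> q_simplices S q"
  shows "finite {G'. up_neighbors S q G' G}"
proof (rule finite_subset)
  show "finite (\<Union>F\<in>cofaces q G. faces q F)"
    using finite_cofaces[OF G] finite_faces by (auto simp: cofaces_def)
  show "{G'. up_neighbors S q G' G} \<subseteq> (\<Union>F\<in>cofaces q G. faces q F)"
    by (auto simp: up_neighbors_def cofaces_def faces_def)
qed

lemma finite_down_neighbors:
  assumes F: "F \<in> q_simplices S (q + 1)"
  shows "finite {F'. down_neighbors S (q + 1) F' F}"
proof (rule finite_subset)
  show "finite (\<Union>G\<in>faces q F. cofaces q G)"
    using finite_faces[OF F] finite_cofaces by (auto simp: faces_def)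
  show "{F'. down_neighbors S (q + 1) F' F} \<subseteq> (\<Union>G\<in>faces q F. cofaces q G)"
  proof
    fix F' assume "F' \<in> {F'. down_neighbors S (q + 1) F' F}"
    then show "F' \<in> (\<Union>G\<in>faces q F. cofaces q G)"
      by (intro UN_I[of "F' \<inter> F"]) (simp_all add: down_neighbors_def cofaces_def faces_def)
  qed
qed

text \<open>The orientation of the common coface enters both incidence numbers and squares away, and
  the coface itself must be \<open>G \<union> G'\<close>; hence the definite description in
  \<open>eta_up\<close> is unique.\<close>

lemma eta_up_oriented:
  assumes nb: "up_neighbors S q G' G" and d: "d \<in> {1, -1}" "d' \<in> {1, -1}"
  shows "eta_up S q (oriented G d) (oriented G' d') =
           d * d' * (face_sgn (G \<union> G') G * face_sgn (G \<union> G') G')"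
proof -
  let ?v = "d * d' * (face_sgn (G \<union> G') G * face_sgn (G \<union> G') G')"
  have G: "G \<in> q_simplices S q" "G' \<in> q_simplices S q"
    using nb by (auto simp: up_neighbors_def)
  note H = up_neighbors_union(1)[OF nb, unfolded Un_commute[of G']]
  have sgn: "incidence_sgn (oriented (G \<union> G') e) (oriented G d) *
             incidence_sgn (oriented (G \<union> G') e) (oriented G' d') = ?v" if e: "e \<in> {1, -1}" for e
    unfolding incidence_sgn_q[OF H G(1) e d(1)] incidence_sgn_q[OF H G(2) e d(2)]
    using e by auto
  show ?thesis
    unfolding eta_up_def
  proof (rule the_equality)
    show "\<exists>\<sigma>\<in>osimplices S (q + 1). underlying (oriented G d) \<subseteq> underlying \<sigma> \<and>
            underlying (oriented G' d') \<subseteq> underlying \<sigma> \<and>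
            ?v = incidence_sgn \<sigma> (oriented G d) * incidence_sgn \<sigma> (oriented G' d')"
      using sgn[of 1] underlying_oriented_q[OF G(1) d(1)] underlying_oriented_q[OF G(2) d(2)]
        underlying_oriented_q[OF H, of 1]
      by (intro bexI[of _ "oriented (G \<union> G') 1"] oriented_in_osimplices[OF H]) auto
  next
    fix x assume "\<exists>\<sigma>\<in>osimplices S (q + 1). underlying (oriented G d) \<subseteq> underlying \<sigma> \<and>
            underlying (oriented G' d') \<subseteq> underlying \<sigma> \<and>
            x = incidence_sgn \<sigma> (oriented G d) * incidence_sgn \<sigma> (oriented G' d')"
    then obtain \<sigma> where \<sigma>: "\<sigma> \<in> osimplices S (q + 1)"
      "G \<subseteq> underlying \<sigma>" "G' \<subseteq> underlying \<sigma>"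
      "x = incidence_sgn \<sigma> (oriented G d) * incidence_sgn \<sigma> (oriented G' d')"
      unfolding underlying_oriented_q[OF G(1) d(1)] underlying_oriented_q[OF G(2) d(2)] by blast
    obtain F e where F: "F \<in> q_simplices S (q + 1)" "e \<in> {1, -1}" "\<sigma> = oriented F e"
      using \<sigma>(1) by (rule osimplicesE)
    then have "F = G \<union> G'"
      using \<sigma> up_neighbors_union(2)[OF nb F(1)] underlying_oriented_q[OF F(1,2)] by auto
    then show "x = ?v" using sgn[OF F(2)] \<sigma>(4) F(3) by simp
  qed
qed

text \<open>Here the orientation of the common face squares away, while its underlying set is pinned
  to the intersection by \<open>eta_down\<close> itself.\<close>

lemma eta_down_oriented:
  assumes nb: "down_neighbors S (q + 1) F' F" and e: "e \<in> {1, -1}" "e' \<in> {1, -1}"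
  shows "eta_down S (q + 1) (oriented F e) (oriented F' e') =
           e * e' * (face_sgn F (F \<inter> F') * face_sgn F' (F \<inter> F'))"
proof -
  let ?v = "e * e' * (face_sgn F (F \<inter> F') * face_sgn F' (F \<inter> F'))"
  have F: "F \<in> q_simplices S (q + 1)" "F' \<in> q_simplices S (q + 1)" and G: "F \<inter> F' \<in> q_simplices S q"
    using nb by (auto simp: down_neighbors_def Int_commute)
  have sgn: "incidence_sgn (oriented F e) (oriented (F \<inter> F') d) *
             incidence_sgn (oriented F' e') (oriented (F \<inter> F') d) = ?v" if d: "d \<in> {1, -1}" for d
    unfolding incidence_sgn_q[OF F(1) G e(1) d] incidence_sgn_q[OF F(2) G e(2) d]
    using d by auto
  note und = underlying_oriented_q[OF F(1) e(1)] underlying_oriented_q[OF F(2) e(2)]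
  show ?thesis
    unfolding eta_down_def und add_diff_cancel_right'
  proof (rule the_equality)
    show "\<exists>\<mu>\<in>osimplices S q. underlying \<mu> = F \<inter> F' \<and>
            ?v = incidence_sgn (oriented F e) \<mu> * incidence_sgn (oriented F' e') \<mu>"
      using sgn[of 1] underlying_oriented_q[OF G, of 1]
      by (intro bexI[of _ "oriented (F \<inter> F') 1"] oriented_in_osimplices[OF G]) auto
  next
    fix x assume "\<exists>\<mu>\<in>osimplices S q. underlying \<mu> = F \<inter> F' \<and>
            x = incidence_sgn (oriented F e) \<mu> * incidence_sgn (oriented F' e') \<mu>"
    then obtain \<mu> where \<mu>: "\<mu> \<in> osimplices S q" "underlying \<mu> = F \<inter> F'"
      "x = incidence_sgn (oriented F e) \<mu> * incidence_sgn (oriented F' e') \<mu>"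
      by blast
    obtain M d where M: "M \<in> q_simplices S q" "d \<in> {1, -1}" "\<mu> = oriented M d"
      using \<mu>(1) by (rule osimplicesE)
    then have "M = F \<inter> F'" using \<mu>(2) underlying_oriented_q[OF M(1,2)] by simp
    then show "x = ?v" using sgn[OF M(2)] \<mu>(3) M(3) by simp
  qed
qed

section \<open>Degrees and the normalising weights\<close>

definition degX :: "nat \<Rightarrow> 'v set \<Rightarrow> nat" where
  "degX q G = card (cofaces q G)"

definition degY :: "nat \<Rightarrow> 'v set \<Rightarrow> nat" where
  "degY q F = card {F'. down_neighbors S q F' F}"

lemma deg_X_oriented:
  "G \<in> q_simplices S q \<Longrightarrow> d \<in> {1, -1} \<Longrightarrow> deg_X S q (oriented G d) = degX q G"
  by (simp only: deg_X_def underlying_oriented_q degX_def cofaces_def)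

lemma deg_Y_oriented:
  assumes "F \<in> q_simplices S q" "e \<in> {1, -1}"
  shows "deg_Y S q (oriented F e) = degY q F"
proof -
  have "{F' \<in> q_simplices S q. down_neighbors S q F' F} = {F'. down_neighbors S q F' F}"
    by (auto simp: down_neighbors_def)
  then show ?thesis
    by (simp only: deg_Y_def underlying_oriented_q[OF assms] degY_def)
qed

text \<open>Weights of absolute value at most 1 preserve square summability, and equal weights on
  both orientations preserve antisymmetry. Both \<open>A_up\<close> and \<open>A_down\<close> are of
  this form.\<close>

lemma weighted_in_cochains:
  fixes w :: "'v osimplex \<Rightarrow> real"
  assumes f: "f \<in> cochains S q" and w: "\<And>\<tau>. \<bar>w \<tau>\<bar> \<le> 1"
    and sym: "\<And>F. F \<in> q_simplices S q \<Longrightarrow> w (oriented F (-1)) = w (oriented F 1)"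
  shows "(\<lambda>\<tau>. of_real (w \<tau>) * f \<tau>) \<in> cochains S q"
proof (rule cochainsI)
  show "(\<lambda>\<tau>. (cmod (of_real (w \<tau>) * f \<tau>))\<^sup>2) summable_on osimplices S q"
  proof (rule summable_on_comparison_test[OF cochains_summable[OF f]])
    fix \<tau>
    have "\<bar>w \<tau>\<bar> * cmod (f \<tau>) \<le> cmod (f \<tau>)"
      using w[of \<tau>] by (intro mult_left_le_one_le) auto
    then show "(cmod (of_real (w \<tau>) * f \<tau>))\<^sup>2 \<le> (cmod (f \<tau>))\<^sup>2"
      by (intro power_mono) (auto simp: norm_mult)
  qed simp
next
  fix F assume F: "F \<in> q_simplices S q"
  show "of_real (w (oriented F (-1))) * f (oriented F (-1)) = - (of_real (w (oriented F 1)) * f (oriented F 1))"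
    using sym[OF F] cochain_oriented[OF f F, of "-1"] by simp
qed (use f in \<open>simp add: cochains_outside\<close>)

lemma inverse_sqrt_nat_le_1: "\<bar>1 / sqrt (real n)\<bar> \<le> 1"
  \<comment> \<open>For \<open>n = 0\<close> the quotient is 0 by convention; otherwise the root is
    at least 1.\<close>
  by (cases "n = 0") auto

lemma A_up_in_cochains: "f \<in> cochains S q \<Longrightarrow> A_up S q f \<in> cochains S q"
  unfolding A_up_def
  by (rule weighted_in_cochains[OF _ inverse_sqrt_nat_le_1]) (auto simp: deg_X_oriented)

lemma A_down_in_cochains: "f \<in> cochains S q \<Longrightarrow> A_down S q f \<in> cochains S q"
  unfolding A_down_def
  by (rule weighted_in_cochains[OF _ inverse_sqrt_nat_le_1]) (auto simp: deg_Y_oriented)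

text \<open>Purity places \<open>G\<close> inside a top-dimensional simplex \<open>H\<close>; adding
  to \<open>G\<close> a vertex of \<open>H\<close> outside it gives a coface.\<close>

lemma degX_pos:
  assumes G: "G \<in> q_simplices S q" and q: "q \<le> cdim S - 1"
  shows "0 < degX q G"
proof -
  have "pure_complex S" "1 \<le> cdim S"
    using standing by (auto simp: standing_assumptions_def)
  then obtain H where H: "H \<in> q_simplices S (cdim S)" "G \<subseteq> H"
    using q_simplicesD[OF G] by (auto simp: pure_complex_def)
  \<comment> \<open>Because \<open>cdim S\<close> is at least 1, the truncated bound on
    \<open>q\<close> means \<open>q < cdim S\<close>.\<close>
  have "card G < card H" using q_simplicesD[OF G] q_simplicesD[OF H(1)] q \<open>1 \<le> cdim S\<close> by simp
  then obtain a where a: "a \<in> H" "a \<notin> G"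
    using H(2) by (metis less_irrefl subsetI subset_antisym)
  have "insert a G \<in> q_simplices S (q + 1)"
    using H a q_simplicesD[OF G] by (intro subset_q_simplices[OF H(1)]) auto
  then have "insert a G \<in> cofaces q G" by (auto simp: cofaces_def)
  then show ?thesis
    using finite_cofaces[OF G] by (auto simp: degX_def card_gt_0_iff)
qed

section \<open>Discriminants as sums over unoriented neighbors\<close>

lemma divide_double: "a / (2 * x) + a / (2 * x) = a / x" for a x :: complex
  by (simp flip: add_divide_distrib mult_2)

text \<open>The two square roots combine to a factor \<open>2 * (q + 1)\<close>. The sign of the
  neighbor occurs in \<open>eta_up\<close> and in the cochain value, so both orientations contribute
  equally and absorb the 2, leaving \<open>1 / (q + 1)\<close>.\<close>

lemma discriminant_up_oriented:
  assumes f: "f \<in> cochains S q" and G: "G \<in> q_simplices S q" and d: "d \<in> {1, -1}"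
  shows "discriminant_up S q f (oriented G d) = of_int d / of_nat (q + 1) *
           (\<Sum>G' | up_neighbors S q G' G. of_int (face_sgn (G \<union> G') G * face_sgn (G \<union> G') G') *
              f (oriented G' 1) / of_real (sqrt (degX q G) * sqrt (degX q G')))"
proof -
  let ?N = "{G'. up_neighbors S q G' G}"
  let ?s = "\<lambda>G'. of_int (face_sgn (G \<union> G') G * face_sgn (G \<union> G') G')"
  let ?h = "\<lambda>\<tau>'. of_int (eta_up S q (oriented G d) \<tau>') * f \<tau>' /
            of_real (sqrt (2 * (real q + 1) * real (deg_X S q (oriented G d))) *
                     sqrt (2 * (real q + 1) * real (deg_X S q \<tau>')))"
  have N: "?N \<subseteq> q_simplices S q" by (auto simp: up_neighbors_def)
  have "discriminant_up S q f (oriented G d) =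
          (\<Sum>\<^sub>\<infinity>\<tau>'\<in>{\<tau>' \<in> osimplices S q. underlying \<tau>' \<in> ?N}. ?h \<tau>')"
    using oriented_in_osimplices[OF G d]
    by (simp add: discriminant_up_def underlying_oriented_q[OF G d])
  also have "\<dots> = (\<Sum>G'\<in>?N. ?h (oriented G' 1) + ?h (oriented G' (-1)))"
    using finite_up_neighbors[OF G] N by (rule infsum_osimplices_over)
  also have "\<dots> = (\<Sum>G'\<in>?N. of_int d / of_nat (q + 1) *
                  (?s G' * f (oriented G' 1) / of_real (sqrt (degX q G) * sqrt (degX q G'))))"
  proof (rule sum.cong)
    fix G' assume "G' \<in> ?N"
    then have nb: "up_neighbors S q G' G" and G': "G' \<in> q_simplices S q" using N by auto
    have r: "sqrt (2 * (real q + 1) * x) * sqrt (2 * (real q + 1) * y) =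
             2 * (real q + 1) * (sqrt x * sqrt y)" for x y
      by (simp add: real_sqrt_mult)
    have summand: "?h (oriented G' d') = of_int d * (?s G' * f (oriented G' 1)) /
        of_real (2 * (real q + 1) * (sqrt (degX q G) * sqrt (degX q G')))" if d': "d' \<in> {1, -1}" for d'
      unfolding eta_up_oriented[OF nb d d'] deg_X_oriented[OF G d] deg_X_oriented[OF G' d']
        cochain_oriented[OF f G' d'] r
      using d' by auto
    have half: "a / of_real (2 * (real q + 1) * t) + a / of_real (2 * (real q + 1) * t) =
        a / of_nat (q + 1) / of_real t" for a :: complex and t
    proof -
      have "complex_of_real (2 * (real q + 1) * t) = 2 * (of_nat (q + 1) * of_real t)" by simp
      then show ?thesis by (simp only: divide_double divide_divide_eq_left)
    qed
    show "?h (oriented G' 1) + ?h (oriented G' (-1)) = of_int d / of_nat (q + 1) *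
            (?s G' * f (oriented G' 1) / of_real (sqrt (degX q G) * sqrt (degX q G')))"
      unfolding summand[OF insertI1] summand[OF insertI2[OF insertI1]] half by simp
  qed simp
  finally show ?thesis by (simp only: sum_distrib_left)
qed

text \<open>As in the up case, except that the roots carry only the 2, which the two orientations
  cancel entirely.\<close>

lemma discriminant_down_oriented:
  assumes f: "f \<in> cochains S (q + 1)" and F: "F \<in> q_simplices S (q + 1)" and e: "e \<in> {1, -1}"
  shows "discriminant_down S (q + 1) f (oriented F e) = of_int e *
           (\<Sum>F' | down_neighbors S (q + 1) F' F. of_int (face_sgn F (F \<inter> F') * face_sgn F' (F \<inter> F')) *
              f (oriented F' 1) / of_real (sqrt (degY (q + 1) F) * sqrt (degY (q + 1) F')))"
proof -
  let ?N = "{F'. down_neighbors S (q + 1) F' F}"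
  let ?s = "\<lambda>F'. of_int (face_sgn F (F \<inter> F') * face_sgn F' (F \<inter> F'))"
  let ?h = "\<lambda>\<tau>'. of_int (eta_down S (q + 1) (oriented F e) \<tau>') * f \<tau>' /
            of_real (sqrt (2 * real (deg_Y S (q + 1) (oriented F e))) * sqrt (2 * real (deg_Y S (q + 1) \<tau>')))"
  have N: "?N \<subseteq> q_simplices S (q + 1)" by (auto simp: down_neighbors_def)
  have "discriminant_down S (q + 1) f (oriented F e) =
          (\<Sum>\<^sub>\<infinity>\<tau>'\<in>{\<tau>' \<in> osimplices S (q + 1). underlying \<tau>' \<in> ?N}. ?h \<tau>')"
    using oriented_in_osimplices[OF F e]
    by (simp add: discriminant_down_def underlying_oriented_q[OF F e])
  also have "\<dots> = (\<Sum>F'\<in>?N. ?h (oriented F' 1) + ?h (oriented F' (-1)))"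
    using finite_down_neighbors[OF F] N by (rule infsum_osimplices_over)
  also have "\<dots> = (\<Sum>F'\<in>?N. of_int e *
                  (?s F' * f (oriented F' 1) / of_real (sqrt (degY (q + 1) F) * sqrt (degY (q + 1) F'))))"
  proof (rule sum.cong)
    fix F' assume "F' \<in> ?N"
    then have nb: "down_neighbors S (q + 1) F' F" and F': "F' \<in> q_simplices S (q + 1)" using N by auto
    have r: "sqrt (2 * x) * sqrt (2 * y) = 2 * (sqrt x * sqrt y)" for x y
      by (simp add: real_sqrt_mult)
    have summand: "?h (oriented F' e') = of_int e * (?s F' * f (oriented F' 1)) /
        of_real (2 * (sqrt (degY (q + 1) F) * sqrt (degY (q + 1) F')))" if e': "e' \<in> {1, -1}" for e'
      unfolding eta_down_oriented[OF nb e e'] deg_Y_oriented[OF F e] deg_Y_oriented[OF F' e']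
        cochain_oriented[OF f F' e'] r
      using e' by auto
    have half: "a / of_real (2 * t) + a / of_real (2 * t) = a / of_real t" for a :: complex and t
      by (simp only: of_real_mult of_real_numeral divide_double)
    show "?h (oriented F' 1) + ?h (oriented F' (-1)) = of_int e *
            (?s F' * f (oriented F' 1) / of_real (sqrt (degY (q + 1) F) * sqrt (degY (q + 1) F')))"
      unfolding summand[OF insertI1] summand[OF insertI2[OF insertI1]] half by simp
  qed simp
  finally show ?thesis by (simp only: sum_distrib_left)
qed

section \<open>Comparison of discriminants with weighted Laplacians\<close>

lemma discriminant_up_eq:
  assumes q: "q \<le> cdim S - 1" and f: "f \<in> cochains S q"
  shows "discriminant_up S q f =
           (\<lambda>\<tau>. 1 / of_nat (q + 1) * (A_up S q (laplacian_up S q (A_up S q f)) \<tau> - f \<tau>))"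
proof
  fix \<tau>
  note Af = A_up_in_cochains[OF f]
  \<comment> \<open>Membership in the cochains makes the outer \<open>A_up\<close> vanish off the
    oriented simplices, where the discriminant is 0 by definition.\<close>
  have L: "laplacian_up S q (A_up S q f) \<in> cochains S q"
    using coboundary_in_cochains[OF Af]
    by (simp add: laplacian_up_def coboundary_adj_eq_boundary boundary_in_cochains)
  show "discriminant_up S q f \<tau> =
          1 / of_nat (q + 1) * (A_up S q (laplacian_up S q (A_up S q f)) \<tau> - f \<tau>)"
  proof (cases "\<tau> \<in> osimplices S q")
    case False
    then show ?thesis
      using cochains_outside[OF f] cochains_outside[OF A_up_in_cochains[OF L]]
      by (simp add: discriminant_up_def)
  next
    case True
    then obtain G d where G: "G \<in> q_simplices S q" and d: "d \<in> {1, -1}" and \<tau>: "\<tau> = oriented G d"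
      by (rule osimplicesE)
    let ?a = "\<lambda>G. complex_of_real (sqrt (degX q G))"
    let ?s = "\<lambda>G'. of_int (face_sgn (G \<union> G') G * face_sgn (G \<union> G') G')"
    let ?R = "\<Sum>G' | up_neighbors S q G' G. ?s G' * f (oriented G' 1) / (?a G * ?a G')"
    have A: "A_up S q h (oriented G' d') = h (oriented G' d') / ?a G'"
      if "G' \<in> q_simplices S q" "d' \<in> {1, -1}" for h G' d'
      using that by (simp only: A_up_def deg_X_oriented of_real_divide of_real_1) simp
    have sq: "?a G * ?a G = of_nat (degX q G)"
      by (simp flip: of_real_mult)
    \<comment> \<open>Below the top dimension purity gives a positive degree, so the weight at
      \<open>G\<close> may be cancelled.\<close>
    have nz: "?a G \<noteq> 0" using degX_pos[OF G q] by simp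
    have "laplacian_up S q (A_up S q f) \<tau> = of_int d * (of_nat (degX q G) * A_up S q f (oriented G 1) +
            (\<Sum>G' | up_neighbors S q G' G. ?s G' * A_up S q f (oriented G' 1)))"
      unfolding \<tau> laplacian_up_oriented[OF Af G d] sum_cofaces_faces[OF G] degX_def by simp
    \<comment> \<open>\<open>?R\<close> carries both weights in its denominators; the factor
      \<open>?a G\<close> pulled out here is removed by the outer \<open>A_up\<close>.\<close>
    also have "(\<Sum>G' | up_neighbors S q G' G. ?s G' * A_up S q f (oriented G' 1)) = ?a G * ?R"
      unfolding sum_distrib_left using nz A by (intro sum.cong) (auto simp: up_neighbors_def)
    \<comment> \<open>The inner weight takes one root from the degree and the outer weight the
      other, so the diagonal becomes the identity that the formula subtracts.\<close>
    also have "of_nat (degX q G) * A_up S q f (oriented G 1) = ?a G * f (oriented G 1)"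
      using nz A[OF G] by (simp flip: sq)
    finally have "A_up S q (laplacian_up S q (A_up S q f)) \<tau> = of_int d * (f (oriented G 1) + ?R)"
      using nz by (simp only: \<tau> A[OF G d]) (simp add: field_simps)
    then show ?thesis
      unfolding \<tau> discriminant_up_oriented[OF f G d] cochain_oriented[OF f G d]
      by (simp add: algebra_simps)
  qed
qed

text \<open>A simplex of dimension \<open>q + 1\<close> has \<open>q + 2\<close> faces, so the
  diagonal of the down Laplacian is exactly the subtracted multiple of the identity. Only the
  neighbor sum survives, and the inner and outer weights supply its two denominators.\<close>

lemma discriminant_down_eq:
  assumes f: "f \<in> cochains S (q + 1)"
  shows "discriminant_down S (q + 1) f =
           A_down S (q + 1) (\<lambda>\<tau>. laplacian_down S (q + 1) (A_down S (q + 1) f) \<tau>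
                                 - of_nat (q + 1 + 1) * A_down S (q + 1) f \<tau>)"
proof
  fix \<tau>
  note Af = A_down_in_cochains[OF f]
  show "discriminant_down S (q + 1) f \<tau> =
          A_down S (q + 1) (\<lambda>\<tau>. laplacian_down S (q + 1) (A_down S (q + 1) f) \<tau>
                                 - of_nat (q + 1 + 1) * A_down S (q + 1) f \<tau>) \<tau>"
  proof (cases "\<tau> \<in> osimplices S (q + 1)")
    case False
    then have "laplacian_down S (q + 1) (A_down S (q + 1) f) \<tau> = 0"
      by (simp add: laplacian_down_def coboundary_def)
    moreover have "A_down S (q + 1) h \<tau> = 0" if "h \<tau> = 0" for h
      using that by (simp add: A_down_def)
    ultimately show ?thesis
      using False cochains_outside[OF Af False] by (simp add: discriminant_down_def)
  next
    case True
    then obtain F e where F: "F \<in> q_simplices S (q + 1)" and e: "e \<in> {1, -1}" and \<tau>: "\<tau> = oriented F e"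
      by (rule osimplicesE)
    let ?a = "\<lambda>F. complex_of_real (sqrt (degY (q + 1) F))"
    let ?s = "\<lambda>F'. of_int (face_sgn F (F \<inter> F') * face_sgn F' (F \<inter> F'))"
    let ?R = "\<Sum>F' | down_neighbors S (q + 1) F' F. ?s F' * A_down S (q + 1) f (oriented F' 1)"
    have A: "A_down S (q + 1) h (oriented F' e') = h (oriented F' e') / ?a F'"
      if "F' \<in> q_simplices S (q + 1)" "e' \<in> {1, -1}" for h F' e'
      using that by (simp only: A_down_def deg_Y_oriented of_real_divide of_real_1) simp
    have "laplacian_down S (q + 1) (A_down S (q + 1) f) \<tau> =
            of_int e * (of_nat (q + 2) * A_down S (q + 1) f (oriented F 1) + ?R)"
      unfolding \<tau> laplacian_down_oriented[OF Af F e] sum_faces_cofaces[OF F] by simp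
    then have "laplacian_down S (q + 1) (A_down S (q + 1) f) \<tau>
                 - of_nat (q + 1 + 1) * A_down S (q + 1) f \<tau> = of_int e * ?R"
      unfolding \<tau> cochain_oriented[OF Af F e] by (simp add: algebra_simps)
    moreover have "discriminant_down S (q + 1) f \<tau> = of_int e * ?R / ?a F"
    proof -
      have "?R / ?a F = (\<Sum>F' | down_neighbors S (q + 1) F' F.
              ?s F' * f (oriented F' 1) / of_real (sqrt (degY (q + 1) F) * sqrt (degY (q + 1) F')))"
        unfolding sum_divide_distrib using A by (intro sum.cong) (auto simp: down_neighbors_def)
      from this[symmetric] show ?thesis
        unfolding \<tau> discriminant_down_oriented[OF f F e] by (simp only: times_divide_eq_right)
    qed
    ultimately show ?thesis
      unfolding \<tau> A[OF F e] by simp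
  qed
qed

end

theorem theorem4p5:
  fixes V :: "'v set" and S :: "'v set set"
  assumes "standing_assumptions V S"
  shows "(\<forall>q::nat. q \<le> cdim S - 1 \<longrightarrow>
            (\<forall>f\<in>cochains S q.
               discriminant_up S q f =
               (\<lambda>\<tau>. 1 / of_nat (q + 1) * (A_up S q (laplacian_up S q (A_up S q f)) \<tau> - f \<tau>)))) \<and>
         (\<forall>q::nat. 1 \<le> q \<and> q \<le> cdim S \<and>
            (q = cdim S \<longrightarrow> (\<exists>F\<in>q_simplices S q. \<exists>G\<in>q_simplices S q. F \<noteq> G)) \<longrightarrow>
            (\<forall>f\<in>cochains S q.
               discriminant_down S q f =
               A_down S q (\<lambda>\<tau>. laplacian_down S q (A_down S q f) \<tau>
                                 - of_nat (q + 1) * A_down S q f \<tau>)))"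
proof -
  interpret std_complex V S by unfold_locales (rule assms)
  show ?thesis
  proof (intro conjI allI impI ballI)
    fix q f assume "q \<le> cdim S - 1" "f \<in> cochains S q"
    then show "discriminant_up S q f =
        (\<lambda>\<tau>. 1 / of_nat (q + 1) * (A_up S q (laplacian_up S q (A_up S q f)) \<tau> - f \<tau>))"
      by (rule discriminant_up_eq)
  next
    fix q f
    assume q: "1 \<le> q \<and> q \<le> cdim S \<and>
        (q = cdim S \<longrightarrow> (\<exists>F\<in>q_simplices S q. \<exists>G\<in>q_simplices S q. F \<noteq> G))"
      and f: "f \<in> cochains S q"
    \<comment> \<open>The down formula is proved in dimension \<open>p + 1\<close>, which covers
      every \<open>q \<ge> 1\<close>.\<close>
    then obtain p where "q = p + 1" by (metis add.commute le_iff_add)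
    with f discriminant_down_eq[of f p] show "discriminant_down S q f =
        A_down S q (\<lambda>\<tau>. laplacian_down S q (A_down S q f) \<tau> - of_nat (q + 1) * A_down S q f \<tau>)"
      by simp
  qed
qed

end
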